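(* Let $\zeta$ be a primitive aperiodic substitution on $\mathcal A=\{1,\dots,m\}$ with substitution matrix $\mathsf S$. Let $\theta$ be the Perron-Frobenius eigenvalue of $\mathsf S$ and let $\vec r,\vec\ell$ be respectively the (right) eigenvectors of $\mathsf S,\mathsf S^t$ corresponding to $\theta$, normalized by the condition $\langle\vec r,\vec\ell\rangle=1$. Then the $m\times m$ matrix of correlation measures $\mathbf\Sigma_\zeta=(\sigma_{a,b})_{a,b\in\mathcal A}$ satisfies $$\mathbf\Sigma_\zeta=\frac{1}{\langle\vec r,\vec1\rangle\langle\vec1,\vec\ell\rangle}\cdot\text{weak*-}\lim_{n\to\infty}\theta^{-n}\,\overline{\mathbf\Pi_n^*(\omega)\mathbf\Pi_n(\omega)}\,d\omega ,$$ where the limit is taken entrywise, over absolutely continuous (complex) measures on $\mathbb T=\mathbb R/\mathbb Z$ with the given densities.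
   Context: Let $m\ge2$ and let $\mathcal A^+$ be the set of nonempty finite words over $\mathcal A$. A substitution is a map $\zeta:\mathcal A\to\mathcal A^+$, extended to words by concatenation. $\mathsf S(i,j)$ is the number of symbols $i$ in $\zeta(j)$; $\zeta$ is primitive if some power of $\mathsf S$ is entrywise strictly positive. $X_\zeta\subset\mathcal A^{\mathbb Z}$ is the set of bi-infinite sequences all of whose finite subwords occur as subwords of $\zeta^n(a)$ for some $a,n$; $T_\zeta$ is the left shift on $X_\zeta$; aperiodic means $X_\zeta$ is infinite; $\mu$ is the unique $T_\zeta$-invariant probability measure. $\vec1=[1,\dots,1]^t$, $\langle\vec x,\vec y\rangle$ is the scalar product in $\mathbb R^m$. The correlation measure $\sigma_{a,b}$ is the complex measure on $\mathbb T$ with $\int_0^1e^{2\pi ik\omega}\,d\sigma_{a,b}(\omega)=\langle\mathbf 1_{[a]}\circ T_\zeta^k,\mathbf 1_{[b]}\rangle_{L^2(\mu)}$, $k\in\mathbb Z$, where $[a]=\{x\in X_\zeta:x_0=a\}$. For a word $u=u_0\cdots u_{\ell-1}$ let $\Phi_a(u,\omega)=\sum_{j:\,u_j=a}e^{-2\pi i\omega j}$. $\mathbf\Pi_n(\omega)$ is the $m\times m$ matrix whose $(b,a)$ entry is $\Phi_a(\zeta^n(b),\omega)$. Equivalently, $\mathbf\Pi_n(\omega)=\mathbf M_{n-1}(\omega)\mathbf M_{n-2}(\omega)\cdots\mathbf M_0(\omega)$, where, writing $\zeta(b)=u_1^{(b)}\cdots u_{k_b}^{(b)}$, $$(\mathbf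 M_{n}(\omega))(b,c)=\sum_{j\le k_b:\,u_j^{(b)}=c}\exp\bigl[-2\pi i\omega\bigl(|\zeta^{n}(u_1^{(b)})|+\cdots+|\zeta^{n}(u_{j-1}^{(b)})|\bigr)\bigr]$$ (the exponent being $0$ for $j=1$). $\mathbf\Pi_n^*$ is the conjugate transpose, and the overline denotes entrywise complex conjugation. *)

theory Defs
  imports "HOL-Library.Sublist" "HOL-Analysis.Analysis" "HOL-Probability.Probability_Measure"
begin

section \<open>Substitutions\<close>

text \<open>The alphabet is a finite type; a substitution is a map into nonempty words.\<close>

definition substitution :: "('a \<Rightarrow> 'a list) \<Rightarrow> bool" where
  "substitution \<zeta> \<longleftrightarrow> (\<forall>a. \<zeta> a \<noteq> [])"

definition subst_word :: "('a \<Rightarrow> 'a list) \<Rightarrow> 'a list \<Rightarrow> 'a list" where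
  "subst_word \<zeta> w = concat (map \<zeta> w)"

definition subst_iter :: "('a \<Rightarrow> 'a list) \<Rightarrow> nat \<Rightarrow> 'a \<Rightarrow> 'a list" where
  "subst_iter \<zeta> n a = (subst_word \<zeta> ^^ n) [a]"

definition subst_matrix :: "('a::finite \<Rightarrow> 'a list) \<Rightarrow> real^'a^'a" where
  "subst_matrix \<zeta> = (\<chi> i j. real (count_list (\<zeta> j) i))"

text \<open>The power operation on the type of vectors acts entrywise, hence the explicit iteration
  of the matrix product.\<close>

definition mat_power :: "real^'n^'n \<Rightarrow> nat \<Rightarrow> real^'n^'n" where
  "mat_power A k = (((**) A) ^^ k) (mat 1)"

definition primitive_subst :: "('a::finite \<Rightarrow> 'a list) \<Rightarrow> bool" where
  "primitive_subst \<zeta> \<longleftrightarrow> (\<exists>k\<ge>1. \<forall>i j. mat_power (subst_matrix \<zeta>) k $ i $ j > 0)"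

definition complex_eigenvalue :: "real^'n^'n \<Rightarrow> complex \<Rightarrow> bool" where
  "complex_eigenvalue A z \<longleftrightarrow>
     (\<exists>v. v \<noteq> 0 \<and> map_matrix complex_of_real A *v v = z *s v)"

text \<open>The Perron-Frobenius eigenvalue of a nonnegative matrix is its largest eigenvalue, that is,
  the real eigenvalue which equals the spectral radius.  At most one number has this property.\<close>

definition perron_frobenius_eigenvalue :: "real^'n^'n \<Rightarrow> real \<Rightarrow> bool" where
  "perron_frobenius_eigenvalue A \<theta> \<longleftrightarrow>
     complex_eigenvalue A (complex_of_real \<theta>) \<and>
     (\<forall>z. complex_eigenvalue A z \<longrightarrow> cmod z \<le> \<theta>)"


section \<open>The substitution dynamical system\<close>

definition subst_space :: "('a \<Rightarrow> 'a list) \<Rightarrow> (int \<Rightarrow> 'a) set" where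
  "subst_space \<zeta> = {x. \<forall>i j. \<exists>a n. sublist (map x [i..j]) (subst_iter \<zeta> n a)}"

definition aperiodic_subst :: "('a \<Rightarrow> 'a list) \<Rightarrow> bool" where
  "aperiodic_subst \<zeta> \<longleftrightarrow> infinite (subst_space \<zeta>)"

text \<open>\<open>left_shift k\<close> is the \<open>k\<close>-th power (\<open>k\<close> any integer) of the left shift \<open>left_shift 1\<close>.\<close>

definition left_shift :: "int \<Rightarrow> (int \<Rightarrow> 'a) \<Rightarrow> (int \<Rightarrow> 'a)" where
  "left_shift k x = (\<lambda>i. x (i + k))"

text \<open>The product \<open>\<sigma>\<close>-algebra below is the Borel \<open>\<sigma>\<close>-algebra of the product of the
  discrete topologies.\<close>

definition shift_invariant_prob :: "('a \<Rightarrow> 'a list) \<Rightarrow> (int \<Rightarrow> 'a) measure \<Rightarrow> bool" where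
  "shift_invariant_prob \<zeta> \<mu> \<longleftrightarrow>
     prob_space \<mu> \<and>
     space \<mu> = subst_space \<zeta> \<and>
     sets \<mu> = sets (restrict_space (Pi\<^sub>M UNIV (\<lambda>_. count_space UNIV)) (subst_space \<zeta>)) \<and>
     left_shift 1 \<in> measurable \<mu> \<mu> \<and>
     distr \<mu> \<mu> (left_shift 1) = \<mu>"

definition letter_cylinder :: "('a \<Rightarrow> 'a list) \<Rightarrow> 'a \<Rightarrow> (int \<Rightarrow> 'a) set" where
  "letter_cylinder \<zeta> a = {x \<in> subst_space \<zeta>. x 0 = a}"

definition correlation ::
  "('a \<Rightarrow> 'a list) \<Rightarrow> (int \<Rightarrow> 'a) measure \<Rightarrow> 'a \<Rightarrow> 'a \<Rightarrow> int \<Rightarrow> complex" where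
  "correlation \<zeta> \<mu> a b k =
     (LINT x|\<mu>. indicator (letter_cylinder \<zeta> a) (left_shift k x)
        * cnj (indicator (letter_cylinder \<zeta> b) x))"


section \<open>Complex measures on the circle\<close>

text \<open>A complex measure on \<open>M\<close> is a countably additive complex-valued function on \<open>sets M\<close>;
  its values outside \<open>sets M\<close> are irrelevant.\<close>

definition complex_measure :: "'b measure \<Rightarrow> ('b set \<Rightarrow> complex) \<Rightarrow> bool" where
  "complex_measure M \<nu> \<longleftrightarrow>
     (\<forall>A :: nat \<Rightarrow> 'b set. range A \<subseteq> sets M \<longrightarrow> disjoint_family A \<longrightarrow>
        (\<lambda>i. \<nu> (A i)) sums \<nu> (\<Union>i. A i))"

text \<open>The complex measure \<open>h dN\<close>.\<close>

definition with_density :: "'b measure \<Rightarrow> ('b \<Rightarrow> complex) \<Rightarrow> 'b set \<Rightarrow> complex" where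
  "with_density N h A = (LINT x:A|N. h x)"

text \<open>The integral of \<open>f\<close> with respect to a complex measure \<open>\<nu>\<close> is the integral of \<open>f h\<close> with
  respect to \<open>N\<close>, where \<open>\<nu> = h dN\<close> with \<open>N\<close> a finite positive measure and \<open>h\<close> integrable.  Every
  complex measure can be so written (e.g. by its polar decomposition, where \<open>N\<close> is the total
  variation and \<open>h\<close> has modulus 1), and the value does not depend on the choice of \<open>N\<close> and \<open>h\<close>.\<close>

definition has_complex_measure_integral ::
  "'b measure \<Rightarrow> ('b set \<Rightarrow> complex) \<Rightarrow> ('b \<Rightarrow> complex) \<Rightarrow> complex \<Rightarrow> bool" where
  "has_complex_measure_integral M \<nu> f I \<longleftrightarrow>
     (\<exists>N h. finite_measure N \<and> sets N = sets M \<and> integrable N h \<and>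
        (\<forall>A\<in>sets M. \<nu> A = with_density N h A) \<and>
        has_bochner_integral N (\<lambda>x. f x * h x) I)"

text \<open>The circle \<open>\<real>/\<int>\<close> with its normalized Lebesgue measure is represented by the fundamental
  domain \<open>[0,1)\<close>, and the continuous functions on it by the continuous functions of period 1
  on the real line.\<close>

definition circle :: "real measure" where
  "circle = restrict_space lborel {0..<1}"

definition circle_continuous :: "(real \<Rightarrow> complex) \<Rightarrow> bool" where
  "circle_continuous f \<longleftrightarrow> continuous_on UNIV f \<and> (\<forall>x. f (x + 1) = f x)"

definition weak_star_limit ::
  "(nat \<Rightarrow> real set \<Rightarrow> complex) \<Rightarrow> (real set \<Rightarrow> complex) \<Rightarrow> bool" where
  "weak_star_limit \<nu> \<rho> \<longleftrightarrow>
     (\<forall>n. complex_measure circle (\<nu> n)) \<and> complex_measure circle \<rho> \<and>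
     (\<forall>f. circle_continuous f \<longrightarrow>
        (\<exists>I J. (\<forall>n. has_complex_measure_integral circle (\<nu> n) f (I n)) \<and>
           has_complex_measure_integral circle \<rho> f J \<and> I \<longlonglongrightarrow> J))"

definition is_correlation_measure ::
  "('a \<Rightarrow> 'a list) \<Rightarrow> (int \<Rightarrow> 'a) measure \<Rightarrow> 'a \<Rightarrow> 'a \<Rightarrow> (real set \<Rightarrow> complex) \<Rightarrow> bool" where
  "is_correlation_measure \<zeta> \<mu> a b \<sigma> \<longleftrightarrow>
     complex_measure circle \<sigma> \<and>
     (\<forall>k::int. has_complex_measure_integral circle \<sigma>
        (\<lambda>\<omega>. exp (2 * of_real pi * \<i> * of_int k * of_real \<omega>)) (correlation \<zeta> \<mu> a b k))"


section \<open>The matrix products\<close>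

definition Phi :: "'a \<Rightarrow> 'a list \<Rightarrow> real \<Rightarrow> complex" where
  "Phi a u \<omega> =
     (\<Sum>j | j < length u \<and> u ! j = a. exp (- 2 * of_real pi * \<i> * of_real \<omega> * of_nat j))"

definition Pi_matrix :: "('a::finite \<Rightarrow> 'a list) \<Rightarrow> nat \<Rightarrow> real \<Rightarrow> complex^'a^'a" where
  "Pi_matrix \<zeta> n \<omega> = (\<chi> b a. Phi a (subst_iter \<zeta> n b) \<omega>)"

definition conj_transpose :: "complex^'n^'m \<Rightarrow> complex^'m^'n" where
  "conj_transpose A = transpose (map_matrix cnj A)"

end

theory Submission
  imports Defs
begin

text \<open>The \<open>k\<close>-th Fourier coefficient of the density \<open>\<theta>\<^sup>-\<^sup>n (\<dots>)(a, b)\<close> is \<open>\<theta>\<^sup>-\<^sup>n\<close> times the number of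
  occurrences in the words \<open>\<zeta>\<^sup>n(c)\<close> of the pattern "\<open>b\<close> at \<open>j\<close> and \<open>a\<close> at \<open>j + k\<close>".  Counting a pattern is
  additive under concatenation up to a bounded error; since \<open>\<theta> > 1\<close> these errors are summable after
  rescaling, and a Doeblin contraction (with the left eigenvector as weight) shows that the counts
  in \<open>\<zeta>\<^sup>n(c)\<close> grow like \<open>g \<theta>\<^sup>n l\<^sub>c\<close>.  Cutting a long factor into blocks \<open>\<zeta>\<^sup>q(c)\<close>, the pattern has a uniform
  frequency \<open>g / \<langle>r, 1\<rangle>\<close> in the points of the subshift, which by invariance is the correlation.  The
  densities are bounded in \<open>L\<^sup>1\<close> by Parseval, so convergence of the coefficients yields weak*
  convergence.\<close>

section \<open>Perron-Frobenius\<close>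

text \<open>The constant arises from two limits of the same g: the coefficients, summed over c, tend
  to \<open>g * \<langle>1, l\<rangle>\<close>, while the correlation is
  \<open>g / \<langle>r, 1\<rangle>\<close>; their quotient is free of g. The length of a word is
  not multiplied exactly by a substitution, but its l-weight is, by \<theta>; lengths are therefore
  controlled through weights. The Doeblin contraction shows only that the rescaled counts become
  proportional to l. That the factor of proportionality converges is a separate matter, settled by
  the sum of the counts weighted with r, whose rescaled increments are geometric. The two
  eigenvectors are given up to a common sign. Both are flipped if necessary, which leaves
  \<open>\<langle>r, l\<rangle>\<close> and the product of the two pairings unchanged. A complex
  measure is here a bare set function, and its integral is defined through some representation,
  possibly a different one for each integrand. Before the coefficients of \<sigma> can be used
  together, the integral of a continuous function must be shown to be independent of that
  choice.\<close>

lemma mat_power_Suc_vec: "mat_power A (Suc k) *v x = A *v (mat_power A k *v x)"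
  by (simp add: mat_power_def matrix_vector_mul_assoc)

lemma mat_power_0_vec: "mat_power A 0 *v x = x"
  by (simp add: mat_power_def)

lemma mat_power_eigenvector:
  assumes "A *v x = c *\<^sub>R x"
  shows "mat_power A k *v x = c ^ k *\<^sub>R x"
  by (induction k)
     (simp_all add: mat_power_0_vec mat_power_Suc_vec assms matrix_vector_mult_scaleR mult.commute)

lemma inner_mat_power_left_eigenvector:
  fixes A :: "real^'n^'n"
  assumes "transpose A *v w = c *\<^sub>R w"
  shows "w \<bullet> (mat_power A k *v x) = c ^ k * (w \<bullet> x)"
proof (induction k)
  case (Suc k)
  have "w \<bullet> (A *v y) = c * (w \<bullet> y)" for y
    using assms by (metis dot_lmul_matrix inner_scaleR_left vector_transpose_matrix transpose_transpose)
  with Suc show ?case by (simp add: mat_power_Suc_vec)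
qed (simp add: mat_power_0_vec)

lemma positive_matrix_vector_pos:
  fixes B :: "real^'n^'n"
  assumes B: "\<And>i j. B $ i $ j > 0" and x: "\<And>i. x $ i \<ge> 0" "x \<noteq> 0"
  shows "(B *v x) $ i > 0"
proof -
  obtain j where j: "x $ j \<noteq> 0" using x(2) by (auto simp: vec_eq_iff)
  have "0 < (\<Sum>j\<in>UNIV. B $ i $ j * x $ j)"
  proof (rule sum_pos2[of _ j])
    show "0 < B $ i $ j * x $ j" using B x(1)[of j] j by (simp add: zero_less_mult_iff)
    show "0 \<le> B $ i $ j' * x $ j'" for j' using less_imp_le[OF B] x(1) by simp
  qed auto
  then show ?thesis by (simp add: matrix_vector_mult_def)
qed

text \<open>A zero image would stay zero up to the positive power. This keeps the denominator of the
  Brouwer map below nonzero.\<close>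

lemma mat_power_pos_imp_image_nonzero:
  fixes A :: "real^'n^'n"
  assumes k: "k \<ge> 1" and pos: "\<And>i j. mat_power A k $ i $ j > 0"
    and x: "\<And>i. x $ i \<ge> 0" "x \<noteq> 0"
  shows "A *v x \<noteq> 0"
proof
  assume 0: "A *v x = 0"
  have "mat_power A (Suc n) *v x = 0" for n
    by (induction n) (simp_all add: mat_power_Suc_vec mat_power_0_vec 0)
  from this[of "k - 1"] positive_matrix_vector_pos[OF pos x] k show False
    by (auto simp: vec_eq_iff)
qed

lemma nonneg_matrix_vector_nonneg:
  fixes A :: "real^'n^'m"
  assumes "\<And>i j. A $ i $ j \<ge> 0" "\<And>i. x $ i \<ge> 0"
  shows "(A *v x) $ i \<ge> 0"
  by (simp add: matrix_vector_mult_def assms sum_nonneg)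

text \<open>Brouwer on the standard simplex: \<open>A x\<close> divided by its coordinate sum has a
  fixed point, which is an eigenvector. A priori it may have zero entries; applying the positive
  power k excludes them.\<close>

lemma positive_eigenvector_exists:
  fixes A :: "real^'n^'n"
  assumes nonneg: "\<And>i j. A $ i $ j \<ge> 0"
    and k: "k \<ge> 1" and pos: "\<And>i j. mat_power A k $ i $ j > 0"
  obtains u c where "\<And>i. u $ i > 0" "c > 0" "A *v u = c *\<^sub>R u"
proof -
  define s :: "real^'n \<Rightarrow> real" where "s x = (\<Sum>i\<in>UNIV. x $ i)" for x
  define T :: "(real^'n) set" where "T = {x. (\<forall>i. x $ i \<ge> 0) \<and> s x = 1}"
  define f where "f x = inverse (s (A *v x)) *\<^sub>R (A *v x)" for x
  have s_cont: "continuous_on X s" for X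
    unfolding s_def by (intro continuous_intros)
  have Tnz: "x \<noteq> 0" if "x \<in> T" for x
    using that by (auto simp: T_def s_def)
  have s_pos: "s x > 0" if x: "\<And>i. x $ i \<ge> 0" "x \<noteq> 0" for x
  proof -
    obtain j where j: "x $ j \<noteq> 0" using x(2) by (auto simp: vec_eq_iff)
    show ?thesis unfolding s_def
      by (rule sum_pos2[of _ j]) (use x(1) j in \<open>auto simp: less_le\<close>)
  qed
  have sA: "s (A *v x) > 0" if "x \<in> T" for x
  proof (rule s_pos)
    show "(A *v x) $ i \<ge> 0" for i
      using nonneg_matrix_vector_nonneg[OF nonneg] that by (auto simp: T_def)
    show "A *v x \<noteq> 0"
      using mat_power_pos_imp_image_nonzero[OF k pos _ Tnz[OF that]] that by (auto simp: T_def)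
  qed
  have "closed T"
  proof -
    have "T = (\<Inter>i. {x. x $ i \<ge> 0}) \<inter> {x. s x = 1}" by (auto simp: T_def)
    moreover have "closed {x::real^'n. x $ i \<ge> 0}" for i
      by (intro closed_Collect_le continuous_intros)
    moreover have "closed {x. s x = 1}"
      by (intro closed_Collect_eq s_cont continuous_intros)
    ultimately show ?thesis by auto
  qed
  moreover have "bounded T"
  proof (rule boundedI)
    fix x assume x: "x \<in> T"
    have "norm x \<le> (\<Sum>i\<in>UNIV. \<bar>x $ i\<bar>)" by (rule norm_le_l1_cart)
    also have "\<dots> = s x" using x by (simp add: s_def T_def)
    finally show "norm x \<le> 1" using x by (simp add: T_def)
  qed
  ultimately have "compact T" by (simp add: compact_eq_bounded_closed)
  moreover have "convex T"
    unfolding convex_def T_def s_def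
    by (auto simp: sum.distrib simp flip: sum_distrib_left)
  moreover have "axis undefined 1 \<in> T"
    by (simp add: T_def s_def axis_def)
  then have "T \<noteq> {}" by blast
  moreover have "continuous_on T f"
    unfolding f_def
    by (intro continuous_intros continuous_on_compose2[OF s_cont[of UNIV]])
       (use sA in force)+
  moreover have "f \<in> T \<rightarrow> T"
  proof
    fix x assume x: "x \<in> T"
    have "s (f x) = inverse (s (A *v x)) * s (A *v x)"
      by (simp add: f_def s_def sum_distrib_left)
    moreover have "(A *v x) $ i \<ge> 0" for i
      using nonneg_matrix_vector_nonneg[OF nonneg] x by (auto simp: T_def)
    ultimately show "f x \<in> T"
      using sA[OF x] by (auto simp: T_def f_def)
  qed
  ultimately obtain u where u: "u \<in> T" "f u = u" by (rule brouwer)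
  define c where "c = s (A *v u)"
  have c: "c > 0" using sA[OF u(1)] by (simp add: c_def)
  have Au: "A *v u = c *\<^sub>R u"
    using u(2) c by (metis c_def divideR_right f_def inverse_eq_divide less_numeral_extra(3))
  have "c ^ k * u $ i > 0" for i
    using positive_matrix_vector_pos[OF pos, of u] u(1) Tnz[OF u(1)]
    by (simp add: mat_power_eigenvector[OF Au] T_def)
  then have "u $ i > 0" for i using c by (simp add: zero_less_mult_iff)
  with c Au that show ?thesis by blast
qed

text \<open>Pairing w with the j-th column of the positive power gives \<open>c ^ k * w $ j\<close>
  on one side and a sum of nonnegative terms, one of them positive, on the other.\<close>

lemma left_eigenvector_pos:
  fixes A :: "real^'n^'n"
  assumes pos: "\<And>i j. mat_power A k $ i $ j > 0"
    and w: "transpose A *v w = c *\<^sub>R w" "\<And>i. w $ i \<ge> 0" "w \<noteq> 0" and c: "c > 0"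
  shows "w $ j > 0"
proof -
  obtain i0 where i0: "w $ i0 \<noteq> 0" using w(3) by (auto simp: vec_eq_iff)
  have "0 < (\<Sum>i\<in>UNIV. w $ i * mat_power A k $ i $ j)"
  proof (rule sum_pos2[of _ i0])
    show "0 < w $ i0 * mat_power A k $ i0 $ j"
      using pos w(2)[of i0] i0 by (simp add: zero_less_mult_iff)
    show "0 \<le> w $ i * mat_power A k $ i $ j" for i
      using less_imp_le[OF pos] w(2) by simp
  qed auto
  also have "\<dots> = w \<bullet> (mat_power A k *v axis j 1)"
    by (simp add: inner_vec_def matrix_vector_mult_basis column_def)
  also have "\<dots> = c ^ k * w $ j"
    by (simp add: inner_mat_power_left_eigenvector[OF w(1)] inner_axis)
  finally show ?thesis using c by (simp add: zero_less_mult_iff)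
qed

text \<open>Pairing \<open>\<bar>w\<bar>\<close> with a positive right eigenvector turns the inequality
  \<open>\<theta> \<bar>w\<bar> \<le> A\<^sup>t \<bar>w\<bar>\<close> into an equality, so \<open>\<bar>w\<bar>\<close> and \<open>w + \<bar>w\<bar>\<close> are nonnegative eigenvectors as
  well, and such vectors are zero or strictly positive.\<close>

lemma perron_frobenius_left_eigenvector_signed:
  fixes A :: "real^'n^'n"
  assumes nonneg: "\<And>i j. A $ i $ j \<ge> 0"
    and k: "k \<ge> 1" and pos: "\<And>i j. mat_power A k $ i $ j > 0"
    and pf: "perron_frobenius_eigenvalue A \<theta>"
    and w: "transpose A *v w = \<theta> *\<^sub>R w" "w \<noteq> 0"
  shows "\<theta> > 0" and "(\<forall>i. w $ i > 0) \<or> (\<forall>i. w $ i < 0)"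
proof -
  obtain u c where u: "\<And>i. u $ i > 0" "c > 0" "A *v u = c *\<^sub>R u"
    using positive_eigenvector_exists[OF nonneg k pos] by blast
  \<comment> \<open>The bound in \<open>perron_frobenius_eigenvalue\<close> ranges over complex
    eigenvalues, so u is cast to a complex vector to obtain \<open>c \<le> \<theta>\<close>.\<close>
  have "complex_eigenvalue A (of_real c)"
    unfolding complex_eigenvalue_def
  proof (intro exI conjI)
    define v :: "complex^'n" where "v = (\<chi> i. of_real (u $ i))"
    show "v \<noteq> 0" using u(1) by (auto simp: v_def vec_eq_iff) (metis less_irrefl)
    have "(\<Sum>j\<in>UNIV. A $ i $ j * u $ j) = c * u $ i" for i
      using u(3) by (simp add: vec_eq_iff matrix_vector_mult_def)
    then have "(\<Sum>j\<in>UNIV. complex_of_real (A $ i $ j) * of_real (u $ j)) = of_real c * of_real (u $ i)"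
      for i
      by (metis (mono_tags, lifting) of_real_mult of_real_sum sum.cong)
    then show "map_matrix complex_of_real A *v v = of_real c *s v"
      by (simp add: vec_eq_iff matrix_vector_mult_def v_def map_matrix_def)
  qed
  then have "c \<le> \<theta>"
    using pf u(2) by (auto simp: perron_frobenius_eigenvalue_def)
  then show \<theta>: "\<theta> > 0" using u(2) by simp
  define a :: "real^'n" where "a = (\<chi> i. \<bar>w $ i\<bar>)"
  have tr: "(transpose A *v y) $ j = (\<Sum>i\<in>UNIV. A $ i $ j * y $ i)" for y j
    by (simp add: matrix_vector_mult_def transpose_def)
  define z where "z = transpose A *v a - \<theta> *\<^sub>R a"
  have z: "z $ j \<ge> 0" for j
  proof -
    have "\<theta> * \<bar>w $ j\<bar> = \<bar>\<Sum>i\<in>UNIV. A $ i $ j * w $ i\<bar>"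
    proof -
      have "\<theta> * w $ j = (\<Sum>i\<in>UNIV. A $ i $ j * w $ i)"
        using w(1) tr[of w j] by simp
      then show ?thesis using \<theta> by (metis abs_mult abs_of_pos)
    qed
    also have "\<dots> \<le> (\<Sum>i\<in>UNIV. A $ i $ j * a $ i)"
      by (rule order_trans[OF sum_abs]) (simp add: abs_mult nonneg a_def)
    finally show ?thesis
      unfolding z_def vector_minus_component tr vector_scaleR_component by (simp add: a_def)
  qed
  have "z \<bullet> u = a \<bullet> (A *v u) - \<theta> * (a \<bullet> u)"
    by (simp add: z_def inner_diff_left dot_lmul_matrix flip: vector_transpose_matrix)
  also have "\<dots> = (c - \<theta>) * (a \<bullet> u)" by (simp add: u(3) algebra_simps)
  also have "\<dots> \<le> 0"
  proof -
    have "a \<bullet> u \<ge> 0"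
      using less_imp_le[OF u(1)] by (auto simp: inner_vec_def a_def intro!: sum_nonneg)
    then show ?thesis using \<open>c \<le> \<theta>\<close> by (simp add: mult_nonpos_nonneg)
  qed
  finally have "(\<Sum>i\<in>UNIV. z $ i * u $ i) \<le> 0" by (simp add: inner_vec_def)
  moreover have nn: "z $ i * u $ i \<ge> 0" for i using z less_imp_le[OF u(1)] by simp
  ultimately have "(\<Sum>i\<in>UNIV. z $ i * u $ i) = 0"
    by (intro antisym sum_nonneg) auto
  then have "z $ i * u $ i = 0" for i
    using nn by (simp add: sum_nonneg_eq_0_iff)
  then have "z $ i = 0" for i using u(1)[of i] by (metis less_irrefl mult_eq_0_iff)
  then have a: "transpose A *v a = \<theta> *\<^sub>R a"
    by (simp add: z_def vec_eq_iff)
  have "a \<noteq> 0" using w(2) by (auto simp: a_def vec_eq_iff)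
  then have apos: "a $ i > 0" for i
    by (intro left_eigenvector_pos[OF pos a _ _ \<theta>]) (auto simp: a_def)
  have wa: "transpose A *v (w + a) = \<theta> *\<^sub>R (w + a)"
    by (simp only: matrix_vector_right_distrib a w(1) scaleR_add_right)
  show "(\<forall>i. w $ i > 0) \<or> (\<forall>i. w $ i < 0)"
  \<comment> \<open>In the first case \<open>w = - a\<close> is negative everywhere. Otherwise
    \<open>w + a\<close> is strictly positive, and an entry \<open>w $ i + \<bar>w $ i\<bar>\<close>
    is positive only if \<open>w $ i\<close> is.\<close>
  proof (cases "w + a = 0")
    case True
    then have "w $ i = - a $ i" for i
      by (metis add_eq_0_iff2 vector_uminus_component)
    then show ?thesis using apos by auto
  next
    case False
    have "(w + a) $ i > 0" for i
      by (intro left_eigenvector_pos[OF pos wa _ False \<theta>]) (auto simp: a_def)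
    then have "w $ i > 0" for i
      by (metis (no_types, lifting) a_def abs_of_nonpos add.right_inverse less_irrefl linorder_not_less
          vec_lambda_beta vector_add_component)
    then show ?thesis by blast
  qed
qed


section \<open>Iterated substitutions and factors of words\<close>

lemma subst_word_funpow: "(subst_word \<zeta> ^^ n) w = concat (map (subst_iter \<zeta> n) w)"
proof -
  have app: "(subst_word \<zeta> ^^ n) (u @ v) = (subst_word \<zeta> ^^ n) u @ (subst_word \<zeta> ^^ n) v" for u v
    by (induction n) (simp_all add: subst_word_def)
  have nil: "(subst_word \<zeta> ^^ n) [] = []"
    by (induction n) (simp_all add: subst_word_def)
  show ?thesis
  proof (induction w)
    case (Cons a w)
    then show ?case using app[of "[a]" w] by (simp add: subst_iter_def)
  qed (simp add: nil)
qed

text \<open>Read in two ways later: with p fixed, a long word is a bounded number of long blocks, so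
  the join errors stay bounded; with n fixed, it is a long sequence of blocks taken from a finite
  list.\<close>

lemma subst_iter_add: "subst_iter \<zeta> (n + p) e = concat (map (subst_iter \<zeta> n) (subst_iter \<zeta> p e))"
  using subst_word_funpow[of n \<zeta> "subst_iter \<zeta> p e"] by (simp add: subst_iter_def funpow_add)

lemma subst_iter_1: "subst_iter \<zeta> 1 e = \<zeta> e"
  by (simp add: subst_iter_def subst_word_def)

lemma subst_iter_0: "subst_iter \<zeta> 0 e = [e]"
  by (simp add: subst_iter_def)

lemma subst_iter_Suc: "subst_iter \<zeta> (Suc n) e = concat (map \<zeta> (subst_iter \<zeta> n e))"
  by (simp add: subst_iter_def subst_word_def)

lemma left_eigenvector_subst_iter:
  fixes l :: "'a \<Rightarrow> real"
  assumes "\<And>e. sum_list (map l (\<zeta> e)) = \<theta> * l e"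
  shows "sum_list (map l (subst_iter \<zeta> n e)) = \<theta> ^ n * l e"
proof (induction n)
  case (Suc n)
  have "sum_list (map l (concat (map \<zeta> w))) = \<theta> * sum_list (map l w)" for w
    by (induction w) (simp_all add: assms algebra_simps)
  then show ?case by (simp add: subst_iter_Suc Suc)
qed (simp add: subst_iter_0)

lemma sum_list_map_count_real:
  fixes f :: "'a::finite \<Rightarrow> real"
  shows "sum_list (map f w) = (\<Sum>d\<in>UNIV. real (count_list w d) * f d)"
proof (induction w)
  case (Cons a w)
  have "(\<Sum>d\<in>UNIV. real (count_list (a # w) d) * f d)
      = (\<Sum>d\<in>UNIV. (if d = a then f d else 0) + real (count_list w d) * f d)"
    by (intro sum.cong) (auto simp: algebra_simps)
  then show ?case using Cons by (simp add: sum.distrib)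
qed simp

lemma count_list_concat_map:
  fixes w :: "'a::finite list"
  shows "real (count_list (concat (map f w)) d) = (\<Sum>c\<in>UNIV. real (count_list (f c) d) * real (count_list w c))"
proof -
  have "real (count_list (concat (map f w)) d) = sum_list (map (\<lambda>c. real (count_list (f c) d)) w)"
    by (induction w) (simp_all add: count_list_append)
  then show ?thesis by (simp add: sum_list_map_count_real mult.commute)
qed

lemma mat_power_subst_matrix:
  "mat_power (subst_matrix \<zeta>) n $ d $ e = real (count_list (subst_iter \<zeta> n e) d)"
proof (induction n arbitrary: d)
  case 0
  then show ?case by (simp add: mat_power_def subst_iter_0 mat_def)
next
  case (Suc n)
  have "mat_power (subst_matrix \<zeta>) (Suc n) = subst_matrix \<zeta> ** mat_power (subst_matrix \<zeta>) n"
    by (simp add: mat_power_def)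
  then show ?case
    by (simp add: matrix_matrix_mult_def Suc subst_iter_Suc count_list_concat_map)
       (simp add: subst_matrix_def)
qed

text \<open>The case of a factor that starts at a block boundary, so that only its end can cut a
  block.\<close>

lemma prefix_concat_decomp:
  assumes "\<And>u. u \<in> set us \<Longrightarrow> length u \<le> M" "prefix w (concat us)"
  obtains vs t where "w = concat vs @ t" "set vs \<subseteq> set us" "length t \<le> M"
  using assms
proof (induction us arbitrary: w thesis)
  case Nil
  then show ?case by force
next
  case (Cons u us)
  from Cons.prems(3) consider "prefix w u" | w' where "w = u @ w'" "prefix w' (concat us)"
    by (auto simp: prefix_append)
  then show ?case
  proof cases
    case 1
    then have "length w \<le> M" using Cons.prems(2)[of u] prefix_length_le[of w u] by simp
    then show ?thesis using Cons.prems(1)[of "[]" w] by simp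
  next
    case 2
    obtain vs t where "w' = concat vs @ t" "set vs \<subseteq> set us" "length t \<le> M"
      using Cons.IH[OF _ _ 2(2)] Cons.prems(2) by (metis list.set_intros(2))
    then show ?thesis using Cons.prems(1)[of "u # vs" t] 2(1) by auto
  qed
qed

text \<open>A factor of a concatenation consists of whole blocks and at most one partial block at
  each end. Of the whole blocks only membership in \<open>set us\<close> is recorded, because the
  later estimate is made block by block.\<close>

lemma sublist_concat_decomp:
  assumes "\<And>u. u \<in> set us \<Longrightarrow> length u \<le> M" "sublist w (concat us)"
  obtains s vs t where "w = s @ concat vs @ t" "set vs \<subseteq> set us" "length s \<le> M" "length t \<le> M"
  using assms
proof (induction us arbitrary: w thesis)
  case Nil
  then show ?case by force
next
  case (Cons u us)
  have M: "length v \<le> M" if "v \<in> set us" for v using Cons.prems(2) that by simp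
  from Cons.prems(3) consider "sublist w u" | "sublist w (concat us)"
    | s w' where "w = s @ w'" "suffix s u" "prefix w' (concat us)"
    by (auto simp: sublist_append)
  then show ?case
  proof cases
    \<comment> \<open>A factor inside a single block contains no whole block and is counted as the
      left end.\<close>
    case 1
    then have "length w \<le> M" using Cons.prems(2)[of u] sublist_length_le[of w u] by simp
    then show ?thesis using Cons.prems(1)[of w "[]" "[]"] by simp
  next
    case 2
    then show ?thesis
      using Cons.IH[OF _ M 2] Cons.prems(1) by (metis list.set_intros(2) subset_code(1))
  next
    case 3
    obtain vs t where "w' = concat vs @ t" "set vs \<subseteq> set us" "length t \<le> M"
      using prefix_concat_decomp[OF M 3(3)] by metis
    moreover have "length s \<le> M" using Cons.prems(2)[of u] 3(2) suffix_length_le[of s u] by simp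
    ultimately show ?thesis using Cons.prems(1)[of s vs t] 3(1) by auto
  qed
qed

section \<open>Quasi-additive functions on words\<close>

text \<open>A quasimorphism on the free monoid with defect at most K. Pattern counts and lengths are
  both of this kind, so one growth theorem serves for both.\<close>

definition quasi_additive :: "('a list \<Rightarrow> real) \<Rightarrow> real \<Rightarrow> bool" where
  "quasi_additive H K \<longleftrightarrow> (\<forall>u v. \<bar>H (u @ v) - H u - H v\<bar> \<le> K)"

lemma quasi_additiveD: "quasi_additive H K \<Longrightarrow> \<bar>H (u @ v) - H u - H v\<bar> \<le> K"
  by (simp add: quasi_additive_def)

lemma quasi_additive_nonneg: "quasi_additive H K \<Longrightarrow> K \<ge> 0"
  using quasi_additiveD[of H K "[]" "[]"] by simp

lemma quasi_additive_Nil: "quasi_additive H K \<Longrightarrow> \<bar>H []\<bar> \<le> K"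
  using quasi_additiveD[of H K "[]" "[]"] by simp

lemma quasi_additive_length: "quasi_additive (\<lambda>u. real (length u)) 0"
  by (simp add: quasi_additive_def)

lemma quasi_additive_diff_length:
  assumes "quasi_additive H K"
  shows "quasi_additive (\<lambda>u. H u - c * real (length u)) K"
  using assms by (simp add: quasi_additive_def algebra_simps)

text \<open>Each block costs one join, and the empty word one more. The error depends on the number
  of blocks and not on their lengths.\<close>

lemma quasi_additive_concat:
  assumes "quasi_additive H K"
  shows "\<bar>H (concat (map f w)) - sum_list (map (\<lambda>c. H (f c)) w)\<bar> \<le> K * (real (length w) + 1)"
proof (induction w)
  case Nil
  then show ?case using quasi_additive_Nil[OF assms] by simp
next
  case (Cons a w)
  then show ?case using quasi_additiveD[OF assms, of "f a" "concat (map f w)"]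
    by (simp add: algebra_simps)
qed

text \<open>If u is built letter by letter, each letter costs its own value and one join; hence the
  choice of C.\<close>

lemma quasi_additive_linear_bound:
  fixes H :: "'a::finite list \<Rightarrow> real"
  assumes "quasi_additive H K"
  obtains C where "C \<ge> 0" "\<And>u. \<bar>H u\<bar> \<le> C * real (length u) + K"
proof -
  define C where "C = (\<Sum>a\<in>UNIV. \<bar>H [a]\<bar>) + K"
  have K: "K \<ge> 0" using quasi_additive_nonneg[OF assms] .
  have "\<bar>H [a]\<bar> \<le> (\<Sum>a\<in>UNIV. \<bar>H [a]\<bar>)" for a
    by (rule member_le_sum) auto
  then have a: "\<bar>H [a]\<bar> + K \<le> C" for a by (simp add: C_def)
  have "\<bar>H u\<bar> \<le> C * real (length u) + K" for u
  proof (induction u)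
    case Nil
    then show ?case using quasi_additive_Nil[OF assms] by simp
  next
    case (Cons x u)
    then show ?case using quasi_additiveD[OF assms, of "[x]" u] a[of x]
      by (simp add: algebra_simps)
  qed
  moreover have "C \<ge> 0" using K by (simp add: C_def sum_nonneg)
  ultimately show ?thesis using that by blast
qed

text \<open>Induction on the number m of contractions: eventually
  \<open>D n \<le> \<rho> ^ m * B + e / 2\<close>. The slack \<open>e / 2\<close> reproduces itself
  once the perturbation is below \<open>(1 - \<rho>) * (e / 2)\<close>, since
  \<open>\<rho> * (e / 2) + (1 - \<rho>) * (e / 2) = e / 2\<close>.\<close>

lemma contraction_perturbed_tendsto_0:
  fixes D :: "nat \<Rightarrow> real"
  assumes nonneg: "\<And>n. D n \<ge> 0" and bdd: "\<And>n. D n \<le> B"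
    and \<rho>: "0 \<le> \<rho>" "\<rho> < 1"
    and step: "\<And>n. D (n + p) \<le> \<rho> * D n + \<epsilon> n" and \<epsilon>: "\<epsilon> \<longlonglongrightarrow> 0"
  shows "D \<longlonglongrightarrow> 0"
proof (rule LIMSEQ_I)
  fix e :: real assume e: "e > 0"
  have "eventually (\<lambda>n. D n \<le> \<rho> ^ m * B + e / 2) sequentially" for m
  proof (induction m)
    case 0
    have "D n \<le> B + e / 2" for n using bdd[of n] e by simp
    then show ?case by simp
  next
    case (Suc m)
    have "eventually (\<lambda>n. \<epsilon> n < (1 - \<rho>) * (e / 2)) sequentially"
      using \<epsilon> e \<rho> by (intro order_tendstoD(2)) auto
    with Suc have "eventually (\<lambda>n. D (n + p) \<le> \<rho> ^ Suc m * B + e / 2) sequentially"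
    proof eventually_elim
      case (elim n)
      have "D (n + p) \<le> \<rho> * D n + \<epsilon> n" by (rule step)
      also have "\<dots> \<le> \<rho> * (\<rho> ^ m * B + e / 2) + (1 - \<rho>) * (e / 2)"
        using elim \<rho> by (intro add_mono mult_left_mono) auto
      finally show ?case by (simp add: field_simps)
    qed
    then show ?case by (rule eventually_sequentially_seg[THEN iffD1])
  qed
  moreover have "(\<lambda>m. \<rho> ^ m * B) \<longlonglongrightarrow> 0"
    using \<rho> by (intro tendsto_mult_left_zero LIMSEQ_realpow_zero) auto
  then have "eventually (\<lambda>m. \<rho> ^ m * B < e / 2) sequentially"
    using e by (intro order_tendstoD(2)) auto
  then obtain m where m: "\<rho> ^ m * B < e / 2"
    by (auto simp: eventually_sequentially)
  ultimately have "eventually (\<lambda>n. D n \<le> \<rho> ^ m * B + e / 2) sequentially" by blast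
  then have "eventually (\<lambda>n. D n < e) sequentially"
    by eventually_elim (use m in linarith)
  then show "\<exists>N. \<forall>n\<ge>N. norm (D n - 0) < e"
    using nonneg by (auto simp: eventually_sequentially)
qed

lemma convergent_of_geometric_increments:
  fixes s :: "nat \<Rightarrow> real"
  assumes "\<And>n. \<bar>s (Suc n) - s n\<bar> \<le> C * q ^ n" "0 \<le> q" "q < 1"
  shows "convergent s"
proof -
  have "summable (\<lambda>n. C * q ^ n)" using assms by (intro summable_mult summable_geometric) auto
  then have "summable (\<lambda>n. s (Suc n) - s n)"
    by (rule summable_comparison_test') (use assms in auto)
  then have "(\<lambda>n. \<Sum>i<n. s (Suc i) - s i) \<longlonglongrightarrow> (\<Sum>i. s (Suc i) - s i)"
    by (rule summable_LIMSEQ)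
  then have "(\<lambda>n. s n - s 0) \<longlonglongrightarrow> (\<Sum>i. s (Suc i) - s i)"
    by (simp add: sum_lessThan_telescope)
  then have "(\<lambda>n. s n - s 0 + s 0) \<longlonglongrightarrow> (\<Sum>i. s (Suc i) - s i) + s 0"
    by (intro tendsto_intros)
  then show ?thesis by (auto simp: convergent_def)
qed


text \<open>The spectral data in terms of words: \<open>left\<close> and \<open>right\<close> are
  the two eigenvector equations written with letter counts, and \<open>mixing\<close> is positivity
  of the p-th matrix power. The left eigenvector has been made positive; for r the sign that matters
  is that of its sum, obtained in \<open>sum_r_pos\<close>.\<close>

locale perron_substitution =
  fixes \<zeta> :: "'a::finite \<Rightarrow> 'a list" and \<theta> :: real and l r :: "'a \<Rightarrow> real" and p :: nat
  assumes left: "\<And>e. sum_list (map l (\<zeta> e)) = \<theta> * l e"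
    and l_pos: "\<And>e. l e > 0"
    and right: "\<And>d. (\<Sum>e\<in>UNIV. real (count_list (\<zeta> e) d) * r e) = \<theta> * r d"
    and normalized: "(\<Sum>e\<in>UNIV. r e * l e) = 1"
    and \<theta>_gt_1: "\<theta> > 1"
    and mixing: "\<And>d e. d \<in> set (subst_iter \<zeta> p e)"
begin

section \<open>Lengths of iterated words compared with the left eigenvector\<close>

definition "l_min = Min (range l)"
definition "l_max = Max (range l)"

lemma l_min_pos: "l_min > 0"
  by (simp add: l_min_def l_pos)

lemma l_min_le: "l_min \<le> l e" and le_l_max: "l e \<le> l_max"
  by (simp_all add: l_min_def l_max_def)

lemma l_max_pos: "l_max > 0"
  using l_pos le_l_max less_le_trans by blast

lemmas left_iter = left_eigenvector_subst_iter[of l \<zeta> \<theta>, OF left]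

text \<open>The l-weight of a word lies between \<open>l_min\<close> and \<open>l_max\<close> times
  its length, and for iterates the weight is known exactly. This bound is uniform in e.\<close>

lemma length_iter_le: "real (length (subst_iter \<zeta> n e)) \<le> \<theta> ^ n * (l_max / l_min)"
proof -
  have "l_min * real (length w) \<le> sum_list (map l w)" for w
    by (induction w) (use l_min_le in \<open>auto simp: algebra_simps add_mono\<close>)
  from this[of "subst_iter \<zeta> n e"]
  have "l_min * real (length (subst_iter \<zeta> n e)) \<le> \<theta> ^ n * l e" by (simp only: left_iter)
  also have "\<dots> \<le> \<theta> ^ n * l_max"
    using le_l_max \<theta>_gt_1 by (intro mult_left_mono) auto
  finally have "l_min * real (length (subst_iter \<zeta> n e)) \<le> \<theta> ^ n * l_max" .
  then show ?thesis using l_min_pos by (simp add: field_simps)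
qed

lemma length_iter_ge: "\<theta> ^ n * (l e / l_max) \<le> real (length (subst_iter \<zeta> n e))"
proof -
  have "sum_list (map l w) \<le> l_max * real (length w)" for w
    by (induction w) (use le_l_max in \<open>auto simp: algebra_simps add_mono\<close>)
  from this[of "subst_iter \<zeta> n e"] show ?thesis
    using l_max_pos by (simp add: left_iter field_simps)
qed

text \<open>This is \<open>\<langle>r, S\<^sup>t V\<rangle> = \<langle>S r, V\<rangle>\<close>.
  Hence a quantity that is additive over blocks has an r-weighted sum that is multiplied exactly by
  \<theta> at each step.\<close>

lemma right_sum: "(\<Sum>e\<in>UNIV. r e * sum_list (map V (\<zeta> e))) = \<theta> * (\<Sum>d\<in>UNIV. r d * V d)"
proof -
  have "(\<Sum>e\<in>UNIV. r e * sum_list (map V (\<zeta> e)))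
      = (\<Sum>d\<in>UNIV. \<Sum>e\<in>UNIV. r e * (real (count_list (\<zeta> e) d) * V d))"
    by (subst sum.swap) (simp add: sum_list_map_count_real sum_distrib_left)
  also have "\<dots> = (\<Sum>d\<in>UNIV. V d * (\<Sum>e\<in>UNIV. real (count_list (\<zeta> e) d) * r e))"
    by (simp add: sum_distrib_left algebra_simps)
  also have "\<dots> = (\<Sum>d\<in>UNIV. V d * (\<theta> * r d))" by (simp only: right)
  finally show ?thesis by (simp add: sum_distrib_left algebra_simps)
qed

text \<open>Rescaling by the left eigenvector turns the action of the substitution into a stochastic
  matrix whose \<open>p\<close>-th power is entrywise positive, so it contracts oscillations (Doeblin).\<close>

theorem quasi_additive_growth:
  assumes H: "quasi_additive H K"
  obtains g where "\<And>e. (\<lambda>n. H (subst_iter \<zeta> n e) / \<theta> ^ n) \<longlonglongrightarrow> g * l e"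
proof -
  define V where "V n e = H (subst_iter \<zeta> n e)" for n e
  define f where "f n e = V n e / (\<theta> ^ n * l e)" for n e
  define D where "D n = Max (range (f n)) - Min (range (f n))" for n
  have \<theta>n: "\<theta> ^ n > 0" for n using \<theta>_gt_1 by simp
  have K: "K \<ge> 0" using quasi_additive_nonneg[OF H] .
  \<comment> \<open>The error does not involve n: the number of joins is determined by the short
    word \<open>subst_iter \<zeta> q e\<close>.\<close>
  have V_step: "\<bar>V (n + q) e - sum_list (map (V n) (subst_iter \<zeta> q e))\<bar>
      \<le> K * (real (length (subst_iter \<zeta> q e)) + 1)" for n q e
    using quasi_additive_concat[OF H, of "subst_iter \<zeta> n" "subst_iter \<zeta> q e"]
    by (simp add: V_def[abs_def] subst_iter_add comp_def)

  obtain C where C: "C \<ge> 0" "\<And>u. \<bar>H u\<bar> \<le> C * real (length u) + K"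
    using quasi_additive_linear_bound[OF H] by blast
  define B where "B = (C * (l_max / l_min) + K) / l_min"
  have f_bound: "\<bar>f n e\<bar> \<le> B" for n e
  proof -
    have "\<bar>V n e\<bar> \<le> C * real (length (subst_iter \<zeta> n e)) + K"
      unfolding V_def by (rule C(2))
    also have "\<dots> \<le> C * (\<theta> ^ n * (l_max / l_min)) + K"
      by (intro add_mono mult_left_mono length_iter_le C(1) order_refl)
    also have "\<dots> \<le> C * (\<theta> ^ n * (l_max / l_min)) + K * \<theta> ^ n"
      using mult_left_mono[OF one_le_power[of \<theta> n] K] \<theta>_gt_1 by simp
    also have "\<dots> = B * (\<theta> ^ n * l_min)"
      using l_min_pos by (simp add: B_def field_simps)
    also have "\<dots> \<le> B * (\<theta> ^ n * l e)"
      using C(1) K l_min_pos l_max_pos l_min_le[of e] \<theta>n[of n]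
      by (intro mult_left_mono) (auto simp: B_def)
    finally show ?thesis
      using \<theta>n[of n] l_pos[of e] by (simp add: f_def abs_mult divide_le_eq)
  qed

  \<comment> \<open>\<eta> is a lower bound for the entries of W: by \<open>mixing\<close> every
    count is at least 1, and the two values of l are replaced by their extremes. W is the transposed
    p-th matrix power conjugated by l; its rows sum to 1 because l is an eigenvector.\<close>
  define \<eta> where "\<eta> = l_min / (\<theta> ^ p * l_max)"
  \<comment> \<open>The join errors of one step from n to \<open>n + p\<close>, summed over e to be
    uniform in the letter.\<close>
  define E where "E = (\<Sum>e\<in>UNIV. K * (real (length (subst_iter \<zeta> p e)) + 1) / (\<theta> ^ p * l e))"
  define W where "W e d = real (count_list (subst_iter \<zeta> p e) d) * l d / (\<theta> ^ p * l e)" for e d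
  have W_sum: "(\<Sum>d\<in>UNIV. W e d) = 1" for e
    using left_iter[of p e] l_pos[of e] \<theta>_gt_1
    by (simp add: W_def sum_list_map_count_real flip: sum_divide_distrib)
  have \<eta>: "\<eta> > 0" using l_min_pos l_max_pos \<theta>n by (simp add: \<eta>_def)
  have W_ge: "W e d \<ge> \<eta>" for e d
  proof -
    have "count_list (subst_iter \<zeta> p e) d \<noteq> 0"
      using mixing[of d e] by (simp add: count_list_0_iff)
    then have "1 \<le> real (count_list (subst_iter \<zeta> p e) d)" by simp
    then have "1 * l_min \<le> real (count_list (subst_iter \<zeta> p e) d) * l d"
      using l_min_le[of d] l_min_pos by (intro mult_mono) auto
    then show ?thesis unfolding W_def \<eta>_def
      using le_l_max[of e] \<theta>n[of p] l_pos[of e] l_pos[of d] l_min_pos by (intro frac_le) auto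
  qed
  have W_nonneg: "W e d \<ge> 0" for e d using W_ge[of e d] \<eta> by simp
  have \<eta>1: "\<eta> \<le> 1"
    using W_ge member_le_sum[of undefined UNIV "W undefined"] W_nonneg W_sum
    by (metis UNIV_I finite order_trans)
  have f_step: "\<bar>f (n + p) e - (\<Sum>d\<in>UNIV. W e d * f n d)\<bar> \<le> E / \<theta> ^ n" for n e
  proof -
    have "(\<Sum>d\<in>UNIV. W e d * f n d)
        = (\<Sum>d\<in>UNIV. real (count_list (subst_iter \<zeta> p e) d) * V n d / (\<theta> ^ (n + p) * l e))"
      by (intro sum.cong refl) (use l_pos in \<open>simp add: W_def f_def power_add field_simps less_imp_neq[symmetric]\<close>)
    also have "\<dots> = sum_list (map (V n) (subst_iter \<zeta> p e)) / (\<theta> ^ (n + p) * l e)"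
      by (simp add: sum_list_map_count_real sum_divide_distrib)
    finally have "f (n + p) e - (\<Sum>d\<in>UNIV. W e d * f n d)
        = (V (n + p) e - sum_list (map (V n) (subst_iter \<zeta> p e))) / (\<theta> ^ (n + p) * l e)"
      by (simp add: f_def diff_divide_distrib)
    then have "\<bar>f (n + p) e - (\<Sum>d\<in>UNIV. W e d * f n d)\<bar>
        = \<bar>V (n + p) e - sum_list (map (V n) (subst_iter \<zeta> p e))\<bar> / (\<theta> ^ (n + p) * l e)"
      using \<theta>n[of "n + p"] l_pos[of e] by (simp add: abs_mult)
    also have "\<dots> \<le> K * (real (length (subst_iter \<zeta> p e)) + 1) / (\<theta> ^ (n + p) * l e)"
      using \<theta>n[of "n + p"] l_pos[of e] V_step by (intro divide_right_mono) auto
    also have "\<dots> = K * (real (length (subst_iter \<zeta> p e)) + 1) / (\<theta> ^ p * l e) / \<theta> ^ n"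
      by (simp add: power_add mult_ac)
    also have "\<dots> \<le> E / \<theta> ^ n"
      unfolding E_def using K \<theta>n l_pos
      by (intro divide_right_mono member_le_sum) (auto simp: less_imp_le)
    finally show ?thesis .
  qed

  have le_Max: "f n d \<le> Max (range (f n))" and Min_le: "Min (range (f n)) \<le> f n d" for n d
    by simp_all
  have D_step: "D (n + p) \<le> (1 - \<eta>) * D n + 2 * (E / \<theta> ^ n)" for n
  proof -
    define M m where "M = Max (range (f n))" and "m = Min (range (f n))"
    have Mm: "m \<le> f n d" "f n d \<le> M" for d using le_Max Min_le by (auto simp: M_def m_def)
    have "m \<in> range (f n)" unfolding m_def by (intro Min_in) auto
    then obtain d0 where d0: "f n d0 = m" by auto
    \<comment> \<open>Every row gives weight at least \<eta> to the letter \<open>d0\<close> where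
      the minimum is attained, which pulls each average below the maximum by
      \<open>\<eta> * (M - m)\<close>. With the plain lower bound m this already shrinks the
      oscillation by \<open>1 - \<eta>\<close>.\<close>
    have upper: "(\<Sum>d\<in>UNIV. W e d * f n d) \<le> M - \<eta> * (M - m)" for e
    proof -
      have "\<eta> * (M - m) \<le> W e d0 * (M - f n d0)"
        using W_ge Mm d0 by (metis diff_ge_0_iff_ge mult_right_mono)
      also have "\<dots> \<le> (\<Sum>d\<in>UNIV. W e d * (M - f n d))"
        using W_nonneg Mm by (intro member_le_sum) auto
      also have "\<dots> = M - (\<Sum>d\<in>UNIV. W e d * f n d)"
        by (simp add: right_diff_distrib sum_subtractf W_sum flip: sum_distrib_right)
      finally show ?thesis by simp
    qed
    have lower: "m \<le> (\<Sum>d\<in>UNIV. W e d * f n d)" for e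
    proof -
      have "m = (\<Sum>d\<in>UNIV. W e d * m)" by (simp add: W_sum flip: sum_distrib_right)
      also have "\<dots> \<le> (\<Sum>d\<in>UNIV. W e d * f n d)"
        using W_nonneg Mm by (intro sum_mono mult_left_mono) auto
      finally show ?thesis .
    qed
    have "Max (range (f (n + p))) \<in> range (f (n + p))" "Min (range (f (n + p))) \<in> range (f (n + p))"
      by (intro Max_in Min_in; simp)+
    then obtain e1 e2 where "Max (range (f (n + p))) = f (n + p) e1" "Min (range (f (n + p))) = f (n + p) e2"
      by blast
    then have "D (n + p) = f (n + p) e1 - f (n + p) e2" by (simp add: D_def)
    also have "\<dots> \<le> M - \<eta> * (M - m) - m + 2 * (E / \<theta> ^ n)"
      using f_step[of n e1] f_step[of n e2] upper[of e1] lower[of e2] by linarith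
    finally show ?thesis by (simp add: D_def M_def m_def algebra_simps)
  qed
  have D_nonneg: "D n \<ge> 0" for n
    using le_Max[of n undefined] Min_le[of n undefined] by (simp add: D_def)
  have D_le: "D n \<le> 2 * B" for n
  proof -
    have "Max (range (f n)) \<le> B" "- B \<le> Min (range (f n))"
      using f_bound by (auto simp: abs_le_iff minus_le_iff)
    then show ?thesis unfolding D_def by linarith
  qed
  have inv_\<theta>: "(\<lambda>n. c / \<theta> ^ n) \<longlonglongrightarrow> 0" for c
    using \<theta>_gt_1 by (intro tendsto_divide_0[OF tendsto_const] filterlim_at_top_imp_at_infinity
      filterlim_realpow_sequentially_gt1[THEN filterlim_mono]) (auto intro: filterlim_pow_at_top)
  have "(\<lambda>n. 2 * (E / \<theta> ^ n)) \<longlonglongrightarrow> 0"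
    using inv_\<theta>[of "2 * E"] by simp
  then have D0: "D \<longlonglongrightarrow> 0"
    using contraction_perturbed_tendsto_0[of D "2 * B" "1 - \<eta>" p, OF D_nonneg D_le _ _ D_step] \<eta> \<eta>1
    by simp

  \<comment> \<open>The vanishing oscillation makes \<open>f n\<close> nearly constant in e; s
    follows that constant. By \<open>right_sum\<close> its increments consist of join errors only,
    of order \<open>1 / \<theta> ^ n\<close>.\<close>
  define s where "s n = (\<Sum>e\<in>UNIV. r e * V n e) / \<theta> ^ n" for n
  define E' where "E' = (\<Sum>e\<in>UNIV. \<bar>r e\<bar> * (K * (real (length (\<zeta> e)) + 1))) / \<theta>"
  have "\<bar>s (Suc n) - s n\<bar> \<le> E' * (1 / \<theta>) ^ n" for n
  proof -
    have "s n = (\<Sum>e\<in>UNIV. r e * sum_list (map (V n) (\<zeta> e))) / \<theta> ^ Suc n"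
      using \<theta>_gt_1 by (simp add: s_def right_sum)
    then have "s (Suc n) - s n
        = (\<Sum>e\<in>UNIV. r e * (V (Suc n) e - sum_list (map (V n) (\<zeta> e)))) / \<theta> ^ Suc n"
      by (simp add: s_def diff_divide_distrib right_diff_distrib sum_subtractf)
    then have "\<bar>s (Suc n) - s n\<bar>
        = \<bar>\<Sum>e\<in>UNIV. r e * (V (Suc n) e - sum_list (map (V n) (\<zeta> e)))\<bar> / \<theta> ^ Suc n"
      using \<theta>n[of "Suc n"] by simp
    also have "\<dots> \<le> (\<Sum>e\<in>UNIV. \<bar>r e\<bar> * (K * (real (length (\<zeta> e)) + 1))) / \<theta> ^ Suc n"
    proof (intro divide_right_mono order_trans[OF sum_abs] sum_mono)
      show "\<bar>r e * (V (Suc n) e - sum_list (map (V n) (\<zeta> e)))\<bar> \<le> \<bar>r e\<bar> * (K * (real (length (\<zeta> e)) + 1))"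
        for e
        using V_step[of n 1 e] by (auto simp: abs_mult subst_iter_1[unfolded One_nat_def] intro!: mult_left_mono)
    qed (use \<theta>n[of "Suc n"] in simp)
    finally show ?thesis by (simp add: E'_def power_divide)
  qed
  then obtain g where g: "s \<longlonglongrightarrow> g"
    using convergent_of_geometric_increments[of s E' "1 / \<theta>"] \<theta>_gt_1 by (auto simp: convergent_def)

  have "(\<lambda>n. H (subst_iter \<zeta> n e) / \<theta> ^ n) \<longlonglongrightarrow> g * l e" for e
  proof -
    \<comment> \<open>By \<open>normalized\<close>, s is an average of the values of
      \<open>f n\<close> with weights \<open>r d * l d\<close> of sum 1. Their signs are not known
      here, hence the absolute values.\<close>
    have "\<bar>f n e - s n\<bar> \<le> (\<Sum>d\<in>UNIV. \<bar>r d * l d\<bar>) * D n" for n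
    proof -
      have "s n = (\<Sum>d\<in>UNIV. r d * l d * f n d)"
        using l_pos \<theta>n
        by (auto simp: s_def f_def sum_divide_distrib less_imp_neq[symmetric] intro!: sum.cong)
      moreover have "f n e = (\<Sum>d\<in>UNIV. r d * l d * f n e)"
        by (simp add: normalized flip: sum_distrib_right)
      ultimately have "f n e - s n = (\<Sum>d\<in>UNIV. r d * l d * (f n e - f n d))"
        by (simp add: right_diff_distrib sum_subtractf)
      also have "\<bar>\<dots>\<bar> \<le> (\<Sum>d\<in>UNIV. \<bar>r d * l d\<bar> * D n)"
      proof (intro order_trans[OF sum_abs] sum_mono)
        fix d
        have "\<bar>f n e - f n d\<bar> \<le> D n"
          using le_Max[of n e] le_Max[of n d] Min_le[of n e] Min_le[of n d] unfolding D_def by linarith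
        then show "\<bar>r d * l d * (f n e - f n d)\<bar> \<le> \<bar>r d * l d\<bar> * D n"
          by (simp only: abs_mult[of "r d * l d"]) (simp add: mult_left_mono)
      qed
      finally show ?thesis by (simp add: sum_distrib_right)
    qed
    moreover have "(\<lambda>n. (\<Sum>d\<in>UNIV. \<bar>r d * l d\<bar>) * D n) \<longlonglongrightarrow> 0"
      using D0 by (rule tendsto_mult_right_zero)
    ultimately have "(\<lambda>n. f n e - s n) \<longlonglongrightarrow> 0"
      by (intro Lim_null_comparison[where f = "\<lambda>n. f n e - s n"]) auto
    from tendsto_mult[OF tendsto_add[OF this g] tendsto_const[of "l e"]]
    have "(\<lambda>n. f n e * l e) \<longlonglongrightarrow> g * l e" by simp
    then show ?thesis using l_pos[of e] by (simp add: f_def V_def)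
  qed
  then show ?thesis using that by blast
qed

text \<open>Length has defect 0, so its r-weighted sum is exactly
  \<open>\<theta> ^ n * sum r UNIV\<close>; comparing with the limit identifies the constant
  g.\<close>

lemma length_growth: "(\<lambda>n. real (length (subst_iter \<zeta> n e)) / \<theta> ^ n) \<longlonglongrightarrow> sum r UNIV * l e"
proof -
  obtain g where g: "\<And>e. (\<lambda>n. real (length (subst_iter \<zeta> n e)) / \<theta> ^ n) \<longlonglongrightarrow> g * l e"
    using quasi_additive_growth[OF quasi_additive_length] by blast
  have "(\<Sum>e\<in>UNIV. r e * real (length (subst_iter \<zeta> n e))) = \<theta> ^ n * sum r UNIV" for n
  proof (induction n)
    case (Suc n)
    have "real (length (subst_iter \<zeta> (Suc n) e))
        = sum_list (map (\<lambda>d. real (length (subst_iter \<zeta> n d))) (\<zeta> e))" for e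
    proof -
      have "real (length (concat us)) = sum_list (map (\<lambda>u. real (length u)) us)" for us :: "'a list list"
        by (induction us) auto
      then show ?thesis using subst_iter_add[of \<zeta> n 1 e] by (simp add: subst_iter_1[unfolded One_nat_def] comp_def)
    qed
    then show ?case by (simp only: right_sum Suc) simp
  qed (simp add: subst_iter_0)
  then have "(\<Sum>e\<in>UNIV. r e * (real (length (subst_iter \<zeta> n e)) / \<theta> ^ n)) = sum r UNIV" for n
    using \<theta>_gt_1 by (simp flip: sum_divide_distrib)
  moreover have "(\<lambda>n. \<Sum>e\<in>UNIV. r e * (real (length (subst_iter \<zeta> n e)) / \<theta> ^ n))
      \<longlonglongrightarrow> (\<Sum>e\<in>UNIV. r e * (g * l e))"
    by (intro tendsto_intros g)
  ultimately have "sum r UNIV = (\<Sum>e\<in>UNIV. r e * (g * l e))"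
    by (simp add: LIMSEQ_const_iff)
  also have "\<dots> = g * (\<Sum>e\<in>UNIV. r e * l e)" by (simp add: sum_distrib_left algebra_simps)
  finally show ?thesis using g by (simp add: normalized)
qed

text \<open>The lower bound \<open>length_iter_ge\<close> survives rescaling and gives
  \<open>l e / l_max \<le> sum r UNIV * l e\<close> in the limit.\<close>

lemma sum_r_pos: "sum r UNIV > 0"
proof -
  have "l e / l_max \<le> real (length (subst_iter \<zeta> n e)) / \<theta> ^ n" for n e
    using length_iter_ge[of n e] \<theta>_gt_1 by (simp add: field_simps)
  then have "l e / l_max \<le> sum r UNIV * l e" for e
    by (intro LIMSEQ_le_const[OF length_growth]) auto
  from this[of undefined] show ?thesis
    using l_pos l_max_pos by (meson divide_pos_pos less_le_trans zero_less_mult_pos2)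
qed

text \<open>Subtracting the expected multiple of the length leaves \<open>H'\<close>, which is small
  relative to the length on the words \<open>\<zeta>\<^sup>q(e)\<close> for large q. Cutting into
  such blocks carries this over to every long factor.\<close>

theorem uniform_frequency:
  assumes H: "quasi_additive H K" and g: "\<And>e. (\<lambda>n. H (subst_iter \<zeta> n e) / \<theta> ^ n) \<longlonglongrightarrow> g * l e"
    and \<epsilon>: "\<epsilon> > 0"
  obtains N where "\<And>w n a. sublist w (subst_iter \<zeta> n a) \<Longrightarrow> N \<le> length w
    \<Longrightarrow> \<bar>H w - g / sum r UNIV * real (length w)\<bar> \<le> \<epsilon> * real (length w)"
proof -
  define H' where "H' u = H u - g / sum r UNIV * real (length u)" for u
  have H': "quasi_additive H' K"
    unfolding H'_def by (rule quasi_additive_diff_length[OF H])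
  have K: "K \<ge> 0" using quasi_additive_nonneg[OF H] .
  have \<theta>n: "\<theta> ^ n > 0" for n using \<theta>_gt_1 by simp
  \<comment> \<open>The summand K pays in advance for the join that each block will cost.\<close>
  have ev: "eventually (\<lambda>n. \<bar>H' (subst_iter \<zeta> n e)\<bar> + K \<le> \<epsilon> / 2 * real (length (subst_iter \<zeta> n e))) sequentially"
    for e
  proof -
    have "(\<lambda>n. H (subst_iter \<zeta> n e) / \<theta> ^ n - g / sum r UNIV * (real (length (subst_iter \<zeta> n e)) / \<theta> ^ n))
        \<longlonglongrightarrow> g * l e - g / sum r UNIV * (sum r UNIV * l e)"
      by (intro tendsto_intros g length_growth)
    then have "(\<lambda>n. H' (subst_iter \<zeta> n e) / \<theta> ^ n) \<longlonglongrightarrow> 0"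
      using sum_r_pos by (simp add: H'_def diff_divide_distrib)
    then have "(\<lambda>n. \<bar>H' (subst_iter \<zeta> n e) / \<theta> ^ n\<bar>) \<longlonglongrightarrow> 0"
      by (rule tendsto_rabs_zero)
    moreover have "(\<lambda>n. K * (1 / \<theta>) ^ n) \<longlonglongrightarrow> 0"
      using \<theta>_gt_1 by (intro tendsto_mult_right_zero LIMSEQ_realpow_zero) auto
    ultimately have "(\<lambda>n. \<epsilon> / 2 * (real (length (subst_iter \<zeta> n e)) / \<theta> ^ n)
        - (\<bar>H' (subst_iter \<zeta> n e) / \<theta> ^ n\<bar> + K * (1 / \<theta>) ^ n)) \<longlonglongrightarrow> \<epsilon> / 2 * (sum r UNIV * l e) - (0 + 0)"
      by (intro tendsto_intros length_growth)
    moreover have "\<epsilon> / 2 * (sum r UNIV * l e) - (0 + 0) > 0"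
      using \<epsilon> sum_r_pos l_pos by simp
    ultimately have "eventually (\<lambda>n. \<epsilon> / 2 * (real (length (subst_iter \<zeta> n e)) / \<theta> ^ n)
        - (\<bar>H' (subst_iter \<zeta> n e) / \<theta> ^ n\<bar> + K * (1 / \<theta>) ^ n) > 0) sequentially"
      by (rule order_tendstoD(1))
    then show ?thesis
    proof eventually_elim
      case (elim n)
      then have "(\<bar>H' (subst_iter \<zeta> n e)\<bar> + K) / \<theta> ^ n
          \<le> \<epsilon> / 2 * real (length (subst_iter \<zeta> n e)) / \<theta> ^ n"
        using \<theta>n[of n] by (simp add: power_one_over add_divide_distrib)
      then show ?case using \<theta>n[of n] unfolding divide_le_cancel by simp
    qed
  qed
  have "eventually (\<lambda>n. \<forall>e. \<bar>H' (subst_iter \<zeta> n e)\<bar> + K \<le> \<epsilon> / 2 * real (length (subst_iter \<zeta> n e))) sequentially"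
    by (intro eventually_all_finite ev)
  then obtain q where q: "\<And>e. \<bar>H' (subst_iter \<zeta> q e)\<bar> + K \<le> \<epsilon> / 2 * real (length (subst_iter \<zeta> q e))"
    by (auto simp: eventually_sequentially)

  \<comment> \<open>All levels up to q are included, so that a factor longer than M can only come
    from an iterate with \<open>n \<ge> q\<close>, which can be cut into blocks.\<close>
  define M where "M = (\<Sum>m\<le>q. \<Sum>e\<in>UNIV. length (subst_iter \<zeta> m e))"
  have M: "length (subst_iter \<zeta> m e) \<le> M" if "m \<le> q" for m e
  proof -
    have "length (subst_iter \<zeta> m e) \<le> (\<Sum>e\<in>UNIV. length (subst_iter \<zeta> m e))"
      by (rule member_le_sum) auto
    also have "\<dots> \<le> M" unfolding M_def by (rule member_le_sum) (use that in auto)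
    finally show ?thesis .
  qed
  obtain C where C: "C \<ge> 0" "\<And>u. \<bar>H' u\<bar> \<le> C * real (length u) + K"
    using quasi_additive_linear_bound[OF H'] by blast
  \<comment> \<open>The two ends contribute \<open>C * real M + K\<close> each, the two joins with
    them K each, and the concatenation of the blocks one more K.\<close>
  define Q where "Q = 5 * K + 2 * (C * real M)"
  \<comment> \<open>\<open>Suc M\<close> forces \<open>n \<ge> q\<close>; the other summand makes Q
    at most half of the allowed error.\<close>
  define N where "N = Suc M + nat \<lceil>2 * Q / \<epsilon>\<rceil>"
  have "\<bar>H' w\<bar> \<le> \<epsilon> * real (length w)" if w: "sublist w (subst_iter \<zeta> n a)" "N \<le> length w" for w n a
  proof -
    have "n \<ge> q"
    proof (rule ccontr)
      assume "\<not> n \<ge> q"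
      then have "length w \<le> M" using M[of n a] sublist_length_le[OF w(1)] by simp
      then show False using w(2) by (simp add: N_def)
    qed
    then have "subst_iter \<zeta> n a = concat (map (subst_iter \<zeta> q) (subst_iter \<zeta> (n - q) a))"
      using subst_iter_add[of \<zeta> q "n - q" a] by simp
    with w(1) have "sublist w (concat (map (subst_iter \<zeta> q) (subst_iter \<zeta> (n - q) a)))" by simp
    then obtain s vs t where dec: "w = s @ concat vs @ t"
        "set vs \<subseteq> set (map (subst_iter \<zeta> q) (subst_iter \<zeta> (n - q) a))" "length s \<le> M" "length t \<le> M"
      by (rule sublist_concat_decomp[rotated]) (use M[of q] in auto)
    have "\<bar>sum_list (map H' vs)\<bar> + K * real (length vs) \<le> \<epsilon> / 2 * real (length (concat vs))"
      using dec(2)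
    proof (induction vs)
      case (Cons v vs)
      then obtain e where "v = subst_iter \<zeta> q e" by auto
      then have "\<bar>H' v\<bar> + K \<le> \<epsilon> / 2 * real (length v)" using q by simp
      then show ?case using Cons by (simp add: algebra_simps add_divide_distrib)
    qed simp
    moreover have "\<bar>H' (concat vs) - sum_list (map H' vs)\<bar> \<le> K * real (length vs) + K"
      using quasi_additive_concat[OF H', of id vs] by (simp add: algebra_simps)
    ultimately have "\<bar>H' (concat vs)\<bar> \<le> \<epsilon> / 2 * real (length (concat vs)) + K" by linarith
    moreover have "\<epsilon> / 2 * real (length (concat vs)) \<le> \<epsilon> / 2 * real (length w)"
      using \<epsilon> dec(1) by simp
    moreover have "\<bar>H' s\<bar> \<le> C * real M + K" "\<bar>H' t\<bar> \<le> C * real M + K"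
      using C(2)[of s] C(2)[of t] mult_left_mono[OF _ C(1), of "real (length s)" "real M"]
        mult_left_mono[OF _ C(1), of "real (length t)" "real M"] dec(3,4) by auto
    ultimately have "\<bar>H' w\<bar> \<le> Q + \<epsilon> / 2 * real (length w)"
      using quasi_additiveD[OF H', of s "concat vs @ t"] quasi_additiveD[OF H', of "concat vs" t]
      unfolding dec(1) Q_def by linarith
    moreover have "Q \<le> \<epsilon> / 2 * real (length w)"
    proof -
      have "2 * Q / \<epsilon> \<le> real (length w)" using w(2) by (simp add: N_def) linarith
      then show ?thesis using \<epsilon> by (simp add: field_simps)
    qed
    ultimately show ?thesis by simp
  qed
  then show ?thesis using that unfolding H'_def by blast
qed

end


section \<open>Pattern counts and invariant measures\<close>

text \<open>Integer positions treat positive and negative k alike; \<open>nat\<close> is applied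
  only to indices already known to lie in the word.\<close>

definition pattern_positions :: "int \<Rightarrow> 'a \<Rightarrow> 'a \<Rightarrow> 'a list \<Rightarrow> int set" where
  "pattern_positions k a b u = {j. 0 \<le> j \<and> j < int (length u) \<and> 0 \<le> j + k \<and> j + k < int (length u) \<and>
     u ! nat j = b \<and> u ! nat (j + k) = a}"

lemma finite_pattern_positions [simp]: "finite (pattern_positions k a b u)"
  by (rule finite_subset[of _ "{0..int (length u)}"]) (auto simp: pattern_positions_def)

text \<open>Besides the occurrences in u and the translated ones in v there are only those with j
  and \<open>j + k\<close> on different sides of the join; such j lie within \<bar>k\<bar> of
  it.\<close>

lemma card_pattern_positions_append:
  "\<bar>real (card (pattern_positions k a b (u @ v))) - real (card (pattern_positions k a b u))
     - real (card (pattern_positions k a b v))\<bar> \<le> 2 * \<bar>of_int k\<bar>"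
proof -
  let ?P = "pattern_positions k a b" and ?n = "int (length u)"
  define S where "S = (\<lambda>j. j + ?n) ` ?P v"
  define X where "X = ?P (u @ v) - (?P u \<union> S)"
  have 1: "?P u \<subseteq> ?P (u @ v)"
    by (auto simp: pattern_positions_def nth_append nat_less_iff)
  have nth: "(u @ v) ! nat (i + ?n) = v ! nat i" if "0 \<le> i" for i
    using that by (simp add: nth_append nat_add_distrib)
  have 2: "S \<subseteq> ?P (u @ v)"
  proof
    fix j assume "j \<in> S"
    then obtain i where "i \<in> ?P v" "j = i + ?n" by (auto simp: S_def)
    then show "j \<in> ?P (u @ v)"
      using nth[of i] nth[of "i + k"] by (simp add: pattern_positions_def ac_simps)
  qed
  have "X \<subseteq> {?n - \<bar>k\<bar>..<?n + \<bar>k\<bar>}"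
  proof
    fix j assume j: "j \<in> X"
    then have jP: "j \<in> ?P (u @ v)" "j \<notin> ?P u" "j \<notin> S" by (auto simp: X_def)
    have "\<not> (j < ?n \<and> j + k < ?n)"
      using jP(1,2) by (auto simp: pattern_positions_def nth_append nat_less_iff)
    moreover have "\<not> (j \<ge> ?n \<and> j + k \<ge> ?n)"
    proof
      assume *: "j \<ge> ?n \<and> j + k \<ge> ?n"
      have "j - ?n \<in> ?P v"
        using jP(1) * nth[of "j - ?n"] nth[of "j + k - ?n"]
        by (simp add: pattern_positions_def algebra_simps)
      then show False using jP(3) by (force simp: S_def)
    qed
    ultimately show "j \<in> {?n - \<bar>k\<bar>..<?n + \<bar>k\<bar>}" by auto
  qed
  then have "card X \<le> card {?n - \<bar>k\<bar>..<?n + \<bar>k\<bar>}" by (intro card_mono) auto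
  then have X: "real (card X) \<le> 2 * \<bar>of_int k\<bar>" by simp
  have "?P (u @ v) = ?P u \<union> S \<union> X" using 1 2 by (auto simp: X_def)
  moreover have "?P u \<inter> S = {}" by (auto simp: S_def pattern_positions_def)
  moreover have "(?P u \<union> S) \<inter> X = {}" by (auto simp: X_def)
  moreover have "finite S" "finite X" by (auto simp: S_def X_def)
  ultimately have "card (?P (u @ v)) = card (?P u) + card S + card X"
    by (simp add: card_Un_disjoint)
  moreover have "card S = card (?P v)"
    unfolding S_def by (intro card_image) (auto simp: inj_on_def)
  ultimately show ?thesis using X by simp
qed

lemma quasi_additive_card_pattern_positions:
  "quasi_additive (\<lambda>u. real (card (pattern_positions k a b u))) (2 * \<bar>of_int k\<bar>)"
  using card_pattern_positions_append by (auto simp: quasi_additive_def)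

section \<open>Invariant measures of pattern cylinders\<close>

lemma left_shift_subst_space: "x \<in> subst_space \<zeta> \<Longrightarrow> left_shift k x \<in> subst_space \<zeta>"
proof -
  assume x: "x \<in> subst_space \<zeta>"
  have "map (left_shift k x) [i..j] = map x [i + k..j + k]" for i j
    by (rule nth_equalityI) (auto simp: left_shift_def nth_upto algebra_simps)
  then show ?thesis using x by (simp add: subst_space_def)
qed

lemma left_shift_add: "left_shift i (left_shift j x) = left_shift (i + j) x"
  by (simp add: left_shift_def fun_eq_iff algebra_simps)

definition pattern_cylinder :: "('a \<Rightarrow> 'a list) \<Rightarrow> int \<Rightarrow> 'a \<Rightarrow> 'a \<Rightarrow> (int \<Rightarrow> 'a) set" where
  "pattern_cylinder \<zeta> k a b = {x \<in> subst_space \<zeta>. x 0 = b \<and> x k = a}"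

lemma sets_pattern_cylinder:
  fixes \<zeta> :: "'a::finite \<Rightarrow> 'a list"
  assumes "shift_invariant_prob \<zeta> \<mu>"
  shows "pattern_cylinder \<zeta> k a b \<in> sets \<mu>"
proof -
  let ?P = "Pi\<^sub>M UNIV (\<lambda>_. count_space UNIV) :: (int \<Rightarrow> 'a) measure"
  have "{x \<in> space ?P. x i = c} \<in> sets ?P" for i c
    by measurable
  then have "{x \<in> space ?P. x 0 = b} \<inter> {x \<in> space ?P. x k = a} \<in> sets ?P"
    by (intro sets.Int) auto
  moreover have "pattern_cylinder \<zeta> k a b
      = subst_space \<zeta> \<inter> ({x \<in> space ?P. x 0 = b} \<inter> {x \<in> space ?P. x k = a})"
    by (auto simp: pattern_cylinder_def space_PiM)
  ultimately show ?thesis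
    using assms by (auto simp: shift_invariant_prob_def sets_restrict_space)
qed

lemma correlation_eq_measure:
  fixes \<zeta> :: "'a::finite \<Rightarrow> 'a list"
  assumes \<mu>: "shift_invariant_prob \<zeta> \<mu>"
  shows "correlation \<zeta> \<mu> a b k = of_real (measure \<mu> (pattern_cylinder \<zeta> k a b))"
proof -
  have "correlation \<zeta> \<mu> a b k = (LINT x|\<mu>. complex_of_real (indicator (pattern_cylinder \<zeta> k a b) x))"
    unfolding correlation_def
    by (intro Bochner_Integration.integral_cong)
       (auto simp: letter_cylinder_def pattern_cylinder_def indicator_def left_shift_def
         left_shift_subst_space[unfolded left_shift_def])
  also have "\<dots> = of_real (LINT x|\<mu>. indicator (pattern_cylinder \<zeta> k a b) x)"
    by (rule integral_complex_of_real)
  also have "\<dots> = of_real (measure \<mu> (pattern_cylinder \<zeta> k a b))"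
    using sets.sets_into_space[OF sets_pattern_cylinder[OF \<mu>, of k a b]]
    by (simp add: Int_absorb2)
  finally show ?thesis .
qed

text \<open>Measurability is proved together with the equality because the change of variables in
  the induction step needs it for the previous shift.\<close>

lemma integral_left_shift:
  assumes \<mu>: "shift_invariant_prob \<zeta> \<mu>" and f: "f \<in> borel_measurable \<mu>"
  shows "(\<lambda>x. f (left_shift (int i) x)) \<in> borel_measurable \<mu> \<and>
    (LINT x|\<mu>. f (left_shift (int i) x)) = (LINT x|\<mu>. f x :: real)"
proof (induction i)
  case 0
  then show ?case using f by (simp add: left_shift_def)
next
  case (Suc i)
  have m: "left_shift 1 \<in> measurable \<mu> \<mu>" and d: "distr \<mu> \<mu> (left_shift 1) = \<mu>"
    using \<mu> by (auto simp: shift_invariant_prob_def)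
  have eq: "(\<lambda>x. f (left_shift (int (Suc i)) x)) = (\<lambda>x. f (left_shift (int i) (left_shift 1 x)))"
    by (simp add: left_shift_add add.commute)
  have "(LINT x|\<mu>. f (left_shift (int i) (left_shift 1 x)))
      = (LINT x|distr \<mu> \<mu> (left_shift 1). f (left_shift (int i) x))"
    using Suc m by (intro integral_distr[symmetric]) auto
  then show ?case using Suc m unfolding eq by (auto simp: d)
qed

text \<open>The sum over shifts counts every j in the window even if \<open>j + k\<close> falls
  outside, the count in the word does not. Such j lie within \<bar>k\<bar> of an end of the
  window.\<close>

lemma window_pattern_count:
  assumes x: "x \<in> subst_space \<zeta>"
  shows "\<bar>(\<Sum>i<N. indicator (pattern_cylinder \<zeta> k a b) (left_shift (int i) x))
    - real (card (pattern_positions k a b (map x [0..int N - 1])))\<bar> \<le> 2 * \<bar>of_int k\<bar>"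
proof -
  define A where "A = {j. 0 \<le> j \<and> j < int N \<and> x j = b \<and> x (j + k) = a}"
  have finA: "finite A" by (rule finite_subset[of _ "{0..int N}"]) (auto simp: A_def)
  have "(\<Sum>i<N. indicator (pattern_cylinder \<zeta> k a b) (left_shift (int i) x))
      = (\<Sum>i<N. if x (int i) = b \<and> x (int i + k) = a then 1 else 0 :: real)"
    by (intro sum.cong)
       (simp_all add: pattern_cylinder_def indicator_def left_shift_subst_space[OF x],
        simp add: left_shift_def add.commute)
  also have "\<dots> = real (card {i. i < N \<and> x (int i) = b \<and> x (int i + k) = a})"
    by (simp add: sum.If_cases) (simp add: Int_def conj_commute)
  also have "card {i. i < N \<and> x (int i) = b \<and> x (int i + k) = a} = card A"
  proof (rule bij_betw_same_card)
    show "bij_betw int {i. i < N \<and> x (int i) = b \<and> x (int i + k) = a} A"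
      by (rule bij_betwI[of _ _ _ nat]) (auto simp: A_def)
  qed
  finally have 1: "(\<Sum>i<N. indicator (pattern_cylinder \<zeta> k a b) (left_shift (int i) x)) = real (card A)" .
  let ?P = "pattern_positions k a b (map x [0..int N - 1])"
  have P: "?P = A \<inter> {j. 0 \<le> j + k \<and> j + k < int N}"
    by (auto simp: pattern_positions_def A_def nth_upto nat_less_iff)
  have "A - ?P \<subseteq> {0..<\<bar>k\<bar>} \<union> {int N - \<bar>k\<bar>..<int N}"
    unfolding P by (auto simp: A_def)
  then have "card (A - ?P) \<le> card ({0..<\<bar>k\<bar>} \<union> {int N - \<bar>k\<bar>..<int N})"
    by (intro card_mono) auto
  also have "\<dots> \<le> nat \<bar>k\<bar> + nat \<bar>k\<bar>"
    by (rule order_trans[OF card_Un_le]) simp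
  finally have "real (card (A - ?P)) \<le> 2 * \<bar>of_int k\<bar>" by linarith
  moreover have "card A = card ?P + card (A - ?P)"
    using finA P by (metis Int_lower1 card_Un_disjoint finite_Diff finite_Int Diff_disjoint Un_Diff_cancel sup.absorb2)
  ultimately show ?thesis unfolding 1 by simp
qed

context perron_substitution
begin

text \<open>By invariance the measure of a cylinder is the integral of the frequency of the pattern in
  a window of any length, and for long windows that frequency is nearly constant.\<close>

theorem measure_pattern_cylinder:
  assumes \<mu>: "shift_invariant_prob \<zeta> \<mu>"
    and g: "\<And>e. (\<lambda>n. real (card (pattern_positions k a b (subst_iter \<zeta> n e))) / \<theta> ^ n) \<longlonglongrightarrow> g * l e"
  shows "measure \<mu> (pattern_cylinder \<zeta> k a b) = g / sum r UNIV"
proof -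
  interpret prob_space \<mu> using \<mu> by (simp add: shift_invariant_prob_def)
  have space: "space \<mu> = subst_space \<zeta>" using \<mu> by (simp add: shift_invariant_prob_def)
  let ?E = "pattern_cylinder \<zeta> k a b"
  define q where "q = measure \<mu> ?E"
  define c where "c = g / sum r UNIV"
  note E = sets_pattern_cylinder[OF \<mu>, of k a b]
  have E_borel: "indicator ?E \<in> borel_measurable \<mu>" using E by simp
  have shifted: "integrable \<mu> (\<lambda>x. indicator ?E (left_shift (int i) x) :: real)"
    "(LINT x|\<mu>. indicator ?E (left_shift (int i) x)) = q" for i
  proof -
    show "integrable \<mu> (\<lambda>x. indicator ?E (left_shift (int i) x) :: real)"
      using integral_left_shift[OF \<mu> E_borel, of i]
      by (intro integrable_const_bound[of _ 1]) (auto simp: indicator_def)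
    show "(LINT x|\<mu>. indicator ?E (left_shift (int i) x)) = q"
      using integral_left_shift[OF \<mu> E_borel, of i] sets.sets_into_space[OF E]
      by (simp add: q_def Int_absorb2)
  qed
  have "\<bar>q - c\<bar> \<le> \<epsilon>" if \<epsilon>: "\<epsilon> > 0" for \<epsilon>
  proof -
    have "\<epsilon> / 2 > 0" using \<epsilon> by simp
    then obtain N0 where N0: "\<And>w n e. sublist w (subst_iter \<zeta> n e) \<Longrightarrow> N0 \<le> length w
        \<Longrightarrow> \<bar>real (card (pattern_positions k a b w)) - c * real (length w)\<bar> \<le> \<epsilon> / 2 * real (length w)"
      using uniform_frequency[OF quasi_additive_card_pattern_positions g] unfolding c_def by metis
    \<comment> \<open>Half of \<epsilon> is spent on the frequency in the window, the other half on
      the boundary error \<open>2 * \<bar>k\<bar>\<close>.\<close>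
    define N where "N = N0 + 1 + nat \<lceil>4 * \<bar>of_int k\<bar> / \<epsilon>\<rceil>"
    have N: "N \<ge> N0" "N > 0" "2 * \<bar>of_int k\<bar> \<le> \<epsilon> / 2 * real N"
    proof -
      have "4 * \<bar>of_int k\<bar> / \<epsilon> \<le> real N" unfolding N_def by linarith
      then show "2 * \<bar>of_int k\<bar> \<le> \<epsilon> / 2 * real N" using \<epsilon> by (simp add: field_simps)
    qed (simp_all add: N_def)
    define F where "F x = (\<Sum>i<N. indicator ?E (left_shift (int i) x)) - real N * c" for x
    have F_int: "integrable \<mu> F" unfolding F_def using shifted by auto
    have "(LINT x|\<mu>. F x) = real N * q - real N * c"
      unfolding F_def using shifted by (simp add: prob_space)
    moreover have "\<bar>LINT x|\<mu>. F x\<bar> \<le> \<epsilon> * real N"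
    proof -
      have F_le: "\<bar>F x\<bar> \<le> \<epsilon> * real N" if "x \<in> space \<mu>" for x
      proof -
        have x: "x \<in> subst_space \<zeta>" using that by (simp add: space)
        \<comment> \<open>The only use of a point of the subshift: its windows are factors of
          iterates, where the frequency is uniform.\<close>
        then obtain e n where "sublist (map x [0..int N - 1]) (subst_iter \<zeta> n e)"
            unfolding subst_space_def by blast
        from N0[OF this] N(1)
        have "\<bar>real (card (pattern_positions k a b (map x [0..int N - 1]))) - c * real N\<bar> \<le> \<epsilon> / 2 * real N"
          by simp
        moreover have "\<bar>y - real N * c\<bar> \<le> \<epsilon> * real N"
          if "\<bar>z - c * real N\<bar> \<le> \<epsilon> / 2 * real N" "\<bar>y - z\<bar> \<le> 2 * \<bar>of_int k\<bar>" for y z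
        proof -
          have "\<bar>y - c * real N\<bar> \<le> \<bar>z - c * real N\<bar> + \<bar>y - z\<bar>" by arith
          also have "\<dots> \<le> \<epsilon> / 2 * real N + \<epsilon> / 2 * real N"
            using that N(3) by (intro add_mono) auto
          finally show ?thesis by (simp add: mult.commute)
        qed
        ultimately show ?thesis
          using window_pattern_count[OF x, where N = N and k = k and a = a and b = b]
          unfolding F_def by blast
      qed
      have "\<bar>LINT x|\<mu>. F x\<bar> \<le> (LINT x|\<mu>. \<bar>F x\<bar>)" by (rule integral_abs_bound)
      also have "\<dots> \<le> (LINT x|\<mu>. \<epsilon> * real N)"
        using F_int F_le by (intro integral_mono) auto
      finally show ?thesis by (simp add: prob_space)
    qed
    ultimately have "\<bar>real N * (q - c)\<bar> \<le> \<epsilon> * real N"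
      by (simp only: right_diff_distrib)
    then show ?thesis using N(2) by (simp add: abs_mult mult.commute[of \<epsilon>])
  qed
  then have "\<bar>q - c\<bar> \<le> 0" by (rule field_le_epsilon) simp
  then show ?thesis by (simp add: q_def c_def)
qed

end


section \<open>Complex measures on the circle\<close>

lemma space_circle [simp]: "space circle = {0..<1}"
  by (simp add: circle_def space_restrict_space)

lemma atLeastLessThan_in_sets_circle: "{a..<b} \<in> sets circle" if "0 \<le> a" "b \<le> 1"
proof -
  have "{a..<b} = {0..<1} \<inter> {a..<b}" using that by auto
  then show ?thesis by (auto simp: circle_def sets_restrict_space)
qed

lemma finite_measure_circle: "finite_measure circle"
  by (rule finite_measureI) (simp add: circle_def emeasure_restrict_space space_restrict_space)

lemma continuous_measurable_circle:
  fixes f :: "real \<Rightarrow> complex"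
  assumes "sets N = sets circle" "continuous_on UNIV f"
  shows "f \<in> borel_measurable N"
proof -
  have "f \<in> borel_measurable lborel" using assms(2) by (simp add: borel_measurable_continuous_onI)
  then have "f \<in> borel_measurable circle" unfolding circle_def by (rule measurable_restrict_space1)
  then show ?thesis using measurable_cong_sets[OF assms(1) refl] by blast
qed

lemma continuous_bounded_on_circle:
  assumes "continuous_on UNIV f"
  obtains B :: real where "\<And>x. x \<in> {0..<1::real} \<Longrightarrow> norm (f x :: complex) \<le> B"
proof -
  have "compact (f ` {0..1})"
    by (intro compact_continuous_image continuous_on_subset[OF assms]) auto
  then obtain B where "\<And>x. x \<in> {0..1} \<Longrightarrow> norm (f x) \<le> B"
    by (meson bounded_iff compact_imp_bounded image_eqI)
  then show ?thesis using that[of B] by simp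
qed

lemma integrable_continuous_mult:
  fixes h :: "real \<Rightarrow> complex"
  assumes "sets N = sets circle" "continuous_on UNIV f" "integrable N h"
  shows "integrable N (\<lambda>x. f x * h x)"
proof -
  obtain B where B: "\<And>x. x \<in> {0..<1} \<Longrightarrow> norm (f x) \<le> B"
    using continuous_bounded_on_circle[OF assms(2)] by blast
  have space: "space N = {0..<1}" using sets_eq_imp_space_eq[OF assms(1)] by simp
  have [measurable]: "f \<in> borel_measurable N" "h \<in> borel_measurable N"
    using continuous_measurable_circle assms by auto
  show ?thesis
  proof (rule Bochner_Integration.integrable_bound)
    show "integrable N (\<lambda>x. B * norm (h x))" using assms(3) by simp
    show "AE x in N. norm (f x * h x) \<le> norm (B * norm (h x))"
      using B by (auto simp: space norm_mult abs_mult intro!: AE_I2 mult_right_mono order_trans[OF _ abs_ge_self])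
  qed simp
qed

text \<open>Finite additivity of the set integral, and its continuity along the increasing unions of
  the first n sets.\<close>

lemma complex_measure_with_density:
  assumes h: "integrable N h" and sets: "sets N = sets M"
  shows "complex_measure M (with_density N h)"
  unfolding complex_measure_def
proof (intro allI impI)
  fix A :: "nat \<Rightarrow> 'a set"
  assume A: "range A \<subseteq> sets M" "disjoint_family A"
  then have meas: "A i \<in> sets N" for i using sets by auto
  have int: "set_integrable N X h" if "X \<in> sets N" for X
    unfolding set_integrable_def using h that by (rule integrable_mult_indicator[rotated])
  have "(LINT x:(\<Union>i<n. A i)|N. h x) = (\<Sum>i<n. LINT x:A i|N. h x)" for n
    by (rule set_integral_finite_Union) (use A(2) meas int in \<open>auto simp: disjoint_family_on_def\<close>)
  moreover have "(\<lambda>n. LINT x:(\<Union>i<n. A i)|N. h x) \<longlonglongrightarrow> (LINT x:(\<Union>n. \<Union>i<n. A i)|N. h x)"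
    using meas by (intro set_integral_cont_up int) (auto simp: incseq_def intro: less_le_trans)
  moreover have "(\<Union>n. \<Union>i<n. A i) = (\<Union>i. A i)" by auto
  ultimately show "(\<lambda>i. with_density N h (A i)) sums with_density N h (\<Union>i. A i)"
    by (simp add: sums_def with_density_def)
qed

text \<open>Riemann sums only involve the set function \<open>with_density N h\<close>, so the integral does not
  depend on its representation by \<open>N\<close> and \<open>h\<close>.\<close>

lemma riemann_sums_tendsto_integral:
  assumes N: "sets N = sets circle" and h: "integrable N h" and f: "continuous_on UNIV f"
  shows "(\<lambda>n. \<Sum>j<Suc n. f (real j / real (Suc n)) *
      with_density N h {real j / real (Suc n)..<real (Suc j) / real (Suc n)})
    \<longlonglongrightarrow> (LINT x|N. f x * h x)"
proof -
  define A where "A n j = {real j / real (Suc n)..<real (Suc j) / real (Suc n)}" for n j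
  define g where "g n x = (\<Sum>j<Suc n. f (real j / real (Suc n)) * (indicator (A n j) x *\<^sub>R h x))" for n x
  obtain B where B: "\<And>x. x \<in> {0..<1} \<Longrightarrow> norm (f x) \<le> B"
    using continuous_bounded_on_circle[OF f] by blast
  have space: "space N = {0..<1}" using sets_eq_imp_space_eq[OF N] by simp
  have A_sets: "A n j \<in> sets N" if "j < Suc n" for n j
    unfolding N A_def using that by (intro atLeastLessThan_in_sets_circle) (auto simp: field_simps)
  have A_int: "integrable N (\<lambda>x. indicator (A n j) x *\<^sub>R h x)" if "j < Suc n" for n j
    by (rule integrable_mult_indicator[OF A_sets[OF that] h])
  \<comment> \<open>The cells \<open>A n j\<close> with \<open>j < Suc n\<close> partition the
    circle, and the one containing x has index \<open>\<lfloor>(n + 1) x\<rfloor>\<close>. So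
    \<open>g n x\<close> is \<open>h x\<close> times the value of f at the left end of that
    cell.\<close>
  have g_eq: "g n x = f (real (nat \<lfloor>real (Suc n) * x\<rfloor>) / real (Suc n)) * h x
      \<and> nat \<lfloor>real (Suc n) * x\<rfloor> < Suc n" if "x \<in> {0..<1}" for n x
  proof -
    define j0 where "j0 = nat \<lfloor>real (Suc n) * x\<rfloor>"
    have nx: "0 \<le> real (Suc n) * x" "real (Suc n) * x < real (Suc n)" using that by auto
    have j0: "j0 < Suc n" unfolding j0_def using nx by linarith
    have "x \<in> A n j \<longleftrightarrow> j = j0" for j
    proof -
      have "x \<in> A n j \<longleftrightarrow> real j \<le> real (Suc n) * x \<and> real (Suc n) * x < real j + 1"
        by (auto simp: A_def field_simps)
      also have "\<dots> \<longleftrightarrow> j = j0" unfolding j0_def using nx(1) by linarith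
      finally show ?thesis .
    qed
    then have "g n x = (\<Sum>j<Suc n. if j = j0 then f (real j / real (Suc n)) * h x else 0)"
      unfolding g_def by (intro sum.cong) auto
    also have "\<dots> = f (real j0 / real (Suc n)) * h x" using j0 by simp
    finally show ?thesis using j0 by (simp add: j0_def)
  qed
  have "(\<lambda>n. LINT x|N. g n x) \<longlonglongrightarrow> (LINT x|N. f x * h x)"
  proof (rule integral_dominated_convergence[where w = "\<lambda>x. B * norm (h x)"])
    show "(\<lambda>x. f x * h x) \<in> borel_measurable N"
      using continuous_measurable_circle[OF N f] h by auto
    show "g n \<in> borel_measurable N" for n
      unfolding g_def using borel_measurable_integrable[OF A_int]
      by (intro borel_measurable_sum borel_measurable_times) auto
    show "integrable N (\<lambda>x. B * norm (h x))" using h by simp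
    show "AE x in N. (\<lambda>n. g n x) \<longlonglongrightarrow> f x * h x"
    proof (intro AE_I2)
      fix x assume "x \<in> space N"
      then have x: "x \<in> {0..<1}" by (simp add: space)
      have "(\<lambda>n. real (nat \<lfloor>real (Suc n) * x\<rfloor>) / real (Suc n)) \<longlonglongrightarrow> x"
      proof (rule tendsto_sandwich[of "\<lambda>n. x - 1 / real (Suc n)" _ _ "\<lambda>n. x"])
        have "x - 1 / real (Suc n) \<le> real (nat \<lfloor>real (Suc n) * x\<rfloor>) / real (Suc n)
            \<and> real (nat \<lfloor>real (Suc n) * x\<rfloor>) / real (Suc n) \<le> x" for n
        proof -
          have "0 \<le> real (Suc n) * x" using x by simp
          then have "real (Suc n) * x - 1 \<le> real (nat \<lfloor>real (Suc n) * x\<rfloor>)"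
            "real (nat \<lfloor>real (Suc n) * x\<rfloor>) \<le> real (Suc n) * x" by linarith+
          moreover have "x - 1 / s \<le> y / s \<and> y / s \<le> x" if "s * x - 1 \<le> y" "y \<le> s * x" "s > 0" for s y
            using that divide_right_mono[OF that(1), of s]
            by (simp add: diff_divide_distrib divide_le_eq mult.commute)
          ultimately show ?thesis by simp
        qed
        then show "eventually (\<lambda>n. x - 1 / real (Suc n) \<le> real (nat \<lfloor>real (Suc n) * x\<rfloor>) / real (Suc n)) sequentially"
          "eventually (\<lambda>n. real (nat \<lfloor>real (Suc n) * x\<rfloor>) / real (Suc n) \<le> x) sequentially"
          by simp_all
        show "(\<lambda>n. x - 1 / real (Suc n)) \<longlonglongrightarrow> x"
          using tendsto_diff[OF tendsto_const LIMSEQ_inverse_real_of_nat, of x]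
          by (simp add: inverse_eq_divide)
      qed simp
      then have "(\<lambda>n. f (real (nat \<lfloor>real (Suc n) * x\<rfloor>) / real (Suc n))) \<longlonglongrightarrow> f x"
        using f by (intro isCont_tendsto_compose[of _ f]) (auto simp: continuous_on_eq_continuous_at)
      then show "(\<lambda>n. g n x) \<longlonglongrightarrow> f x * h x"
        using g_eq[OF x] by (simp add: tendsto_mult_right)
    qed
    show "AE x in N. norm (g n x) \<le> B * norm (h x)" for n
    proof (intro AE_I2)
      fix x assume "x \<in> space N"
      then have x: "x \<in> {0..<1}" by (simp add: space)
      have "real (nat \<lfloor>real (Suc n) * x\<rfloor>) / real (Suc n) \<in> {0..<1}"
        using g_eq[OF x, of n] by (simp add: divide_less_eq)
      then show "norm (g n x) \<le> B * norm (h x)"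
        using g_eq[OF x, of n] B by (simp add: norm_mult mult_right_mono)
    qed
  qed
  moreover have "(LINT x|N. g n x) = (\<Sum>j<Suc n. f (real j / real (Suc n)) * with_density N h (A n j))" for n
    unfolding g_def with_density_def set_lebesgue_integral_def integral_mult_right_zero[symmetric]
    by (intro Bochner_Integration.integral_sum integrable_mult_right A_int) simp
  ultimately show ?thesis unfolding A_def by simp
qed

text \<open>Two representations of \<nu> agree on half-open intervals and hence have the same
  Riemann sums. This allows all coefficients of \<sigma> to be computed with one fixed pair N,
  h.\<close>

lemma has_complex_measure_integral_unique:
  assumes I: "has_complex_measure_integral circle \<nu> f I" and f: "continuous_on UNIV f"
    and N: "sets N = sets circle" "integrable N h" "\<And>A. A \<in> sets circle \<Longrightarrow> \<nu> A = with_density N h A"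
  shows "(LINT x|N. f x * h x) = I"
proof -
  obtain N' h' where N': "sets N' = sets circle" "integrable N' h'"
      "\<And>A. A \<in> sets circle \<Longrightarrow> \<nu> A = with_density N' h' A"
      "has_bochner_integral N' (\<lambda>x. f x * h' x) I"
    using I by (auto simp: has_complex_measure_integral_def)
  have "with_density N h {real j / real (Suc n)..<real (Suc j) / real (Suc n)}
      = with_density N' h' {real j / real (Suc n)..<real (Suc j) / real (Suc n)}" if "j < Suc n" for j n
  proof -
    have "{real j / real (Suc n)..<real (Suc j) / real (Suc n)} \<in> sets circle"
      using that by (intro atLeastLessThan_in_sets_circle) (auto simp: field_simps)
    then show ?thesis using N(3) N'(3) by metis
  qed
  then have eq: "(\<lambda>n. \<Sum>j<Suc n. f (real j / real (Suc n)) *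
      with_density N h {real j / real (Suc n)..<real (Suc j) / real (Suc n)})
    = (\<lambda>n. \<Sum>j<Suc n. f (real j / real (Suc n)) *
      with_density N' h' {real j / real (Suc n)..<real (Suc j) / real (Suc n)})"
    by (intro ext sum.cong) auto
  have "(LINT x|N. f x * h x) = (LINT x|N'. f x * h' x)"
    by (rule LIMSEQ_unique[OF riemann_sums_tendsto_integral[OF N(1,2) f, unfolded eq]
        riemann_sums_tendsto_integral[OF N'(1,2) f]])
  also have "\<dots> = I" using N'(4) by (rule has_bochner_integral_integral_eq)
  finally show ?thesis .
qed

section \<open>Trigonometric polynomials\<close>

definition circle_char :: "int \<Rightarrow> real \<Rightarrow> complex" where
  "circle_char k \<omega> = exp (2 * of_real pi * \<i> * of_int k * of_real \<omega>)"

lemma circle_char_eq_cis: "circle_char k \<omega> = cis (2 * pi * of_int k * \<omega>)"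
  by (simp add: circle_char_def cis_conv_exp mult_ac)

lemma circle_char_0 [simp]: "circle_char 0 \<omega> = 1"
  by (simp add: circle_char_def)

lemma circle_char_add: "circle_char j \<omega> * circle_char k \<omega> = circle_char (j + k) \<omega>"
  by (simp add: circle_char_eq_cis cis_mult algebra_simps)

lemma cnj_circle_char: "cnj (circle_char k \<omega>) = circle_char (- k) \<omega>"
  by (simp add: circle_char_eq_cis cis_cnj)

lemma continuous_circle_char: "continuous_on S (circle_char k)"
  unfolding circle_char_def by (intro continuous_intros)

lemma circle_continuous_circle_char: "circle_continuous (circle_char k)"
proof -
  have "cis (2 * pi * of_int k * (x + 1)) = cis (2 * pi * of_int k * x) * cis (2 * pi * of_int k)" for x
    by (simp add: cis_mult algebra_simps)
  moreover have "cis (2 * pi * of_int k) = 1"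
    using cis_multiple_2pi[of "of_int k"] by (simp add: mult.commute)
  ultimately have "circle_char k (x + 1) = circle_char k x" for x
    by (simp add: circle_char_eq_cis)
  then show ?thesis by (simp add: circle_continuous_def continuous_circle_char)
qed

lemma integral_circle_char: "(LINT \<omega>|circle. circle_char k \<omega>) = (if k = 0 then 1 else 0)"
proof -
  have "(LINT \<omega>|circle. circle_char k \<omega>) = (LINT \<omega>:{0..<1}|lborel. circle_char k \<omega>)"
    unfolding circle_def set_lebesgue_integral_def by (subst integral_restrict_space) auto
  \<comment> \<open>The null set \<open>{1}\<close> is added because the fundamental theorem of
    calculus is applied on a closed interval.\<close>
  also have "\<dots> = (LINT \<omega>:{0..1}|lborel. circle_char k \<omega>)"
    unfolding set_lebesgue_integral_def
  proof (rule integral_cong_AE)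
    show "AE \<omega> in lborel. indicat_real {0..<1} \<omega> *\<^sub>R circle_char k \<omega> = indicat_real {0..1} \<omega> *\<^sub>R circle_char k \<omega>"
      using AE_lborel_singleton[of "1::real"] by eventually_elim (auto simp: indicator_def)
  qed (use borel_measurable_continuous_onI[OF continuous_circle_char] in simp_all)
  also have "\<dots> = (if k = 0 then 1 else 0)"
  proof (cases "k = 0")
    case False
    define F where "F \<omega> = circle_char k \<omega> / (2 * of_real pi * \<i> * of_int k)" for \<omega>
    have "has_bochner_integral lborel (\<lambda>\<omega>. indicator {0..1} \<omega> *\<^sub>R circle_char k \<omega>) (F 1 - F 0)"
    proof (rule has_bochner_integral_FTC_Icc)
      show "(F has_vector_derivative circle_char k \<omega>) (at \<omega> within {0..1})" for \<omega>
      proof -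
        have "((\<lambda>z. exp (2 * of_real pi * \<i> * of_int k * z) / (2 * of_real pi * \<i> * of_int k))
            has_field_derivative circle_char k \<omega>) (at (of_real \<omega>))"
          using False unfolding circle_char_def by (auto intro!: derivative_eq_intros)
        from has_vector_derivative_real_field[OF this] show ?thesis
          by (simp add: F_def[abs_def] circle_char_def has_vector_derivative_at_within)
      qed
    qed (auto intro: continuous_circle_char)
    moreover have "F 1 = F 0"
      using circle_continuous_circle_char[of k] unfolding F_def circle_continuous_def
      by (metis add_0)
    ultimately show ?thesis
      using False by (simp add: set_lebesgue_integral_def has_bochner_integral_iff)
  qed (simp add: set_lebesgue_integral_def)
  finally show ?thesis .
qed

text \<open>Generation by monomials and sums replaces explicit coefficient families: closure under
  products and the convergence of integrals are then inductions along linearity.\<close>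

inductive trig_polynomial :: "(real \<Rightarrow> complex) \<Rightarrow> bool" where
  monomial: "trig_polynomial (\<lambda>\<omega>. c * circle_char k \<omega>)"
| add: "trig_polynomial s \<Longrightarrow> trig_polynomial t \<Longrightarrow> trig_polynomial (\<lambda>\<omega>. s \<omega> + t \<omega>)"

lemma trig_polynomial_const: "trig_polynomial (\<lambda>\<omega>. c)"
  using monomial[of c 0] by simp

lemma trig_polynomial_mult:
  assumes "trig_polynomial s" "trig_polynomial t"
  shows "trig_polynomial (\<lambda>\<omega>. s \<omega> * t \<omega>)"
  using assms
proof (induction s rule: trig_polynomial.induct)
  case (monomial c k)
  from monomial.prems show ?case
  proof (induction t rule: trig_polynomial.induct)
    case (monomial c' k')
    have "(\<lambda>\<omega>. c * circle_char k \<omega> * (c' * circle_char k' \<omega>)) = (\<lambda>\<omega>. (c * c') * circle_char (k + k') \<omega>)"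
      by (simp add: fun_eq_iff flip: circle_char_add)
    then show ?case by (simp only: trig_polynomial.monomial)
  next
    case (add s t)
    then show ?case using trig_polynomial.add[OF add.IH] by (simp add: distrib_left)
  qed
next
  case (add s s')
  then show ?case using trig_polynomial.add[of "\<lambda>\<omega>. s \<omega> * t \<omega>" "\<lambda>\<omega>. s' \<omega> * t \<omega>"]
    by (simp add: distrib_right)
qed

lemma continuous_trig_polynomial: "trig_polynomial t \<Longrightarrow> continuous_on S t"
  by (induction rule: trig_polynomial.induct) (intro continuous_intros continuous_circle_char; assumption)+

text \<open>A real-linear functional on the complex plane has the form
  \<open>\<alpha> * z + \<beta> * cnj z\<close>, and on the unit circle these are the characters 1
  and -1. Sums and products follow by closure.\<close>

lemma trig_polynomial_real_polynomial_cis: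
  assumes "real_polynomial_function (P :: complex \<Rightarrow> real)"
  shows "trig_polynomial (\<lambda>\<omega>. of_real (P (circle_char 1 \<omega>)))"
  using assms
proof (induction P rule: real_polynomial_function.induct)
  case (linear P)
  interpret bounded_linear P by fact
  have P_eq: "complex_of_real (P z) = (of_real (P 1) - \<i> * of_real (P \<i>)) / 2 * z
      + (of_real (P 1) + \<i> * of_real (P \<i>)) / 2 * cnj z" for z
  proof -
    have "z = Re z *\<^sub>R 1 + Im z *\<^sub>R \<i>" by (simp add: complex_eq_iff)
    then have "P z = P (Re z *\<^sub>R 1 + Im z *\<^sub>R \<i>)" by simp
    also have "\<dots> = Re z * P 1 + Im z * P \<i>" by (simp add: add scaleR)
    finally show ?thesis by (simp add: complex_eq_iff field_simps)
  qed
  have "(\<lambda>\<omega>. complex_of_real (P (circle_char 1 \<omega>)))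
      = (\<lambda>\<omega>. (of_real (P 1) - \<i> * of_real (P \<i>)) / 2 * circle_char 1 \<omega>
        + (of_real (P 1) + \<i> * of_real (P \<i>)) / 2 * circle_char (- 1) \<omega>)"
    by (intro ext) (subst P_eq, simp add: cnj_circle_char)
  then show ?case by (simp only: trig_polynomial.add trig_polynomial.monomial)
next
  case (const c)
  then show ?case by (rule trig_polynomial_const)
next
  case (add P Q)
  then show ?case using trig_polynomial.add by fastforce
next
  case (mult P Q)
  then show ?case using trig_polynomial_mult by fastforce
qed

text \<open>Across the negative real axis \<open>Arg\<close> jumps by \<open>2 * pi\<close>, which
  the period of f absorbs. For the proof the branch is turned: \<open>Arg (- w) + pi\<close> is
  continuous near that axis and equals \<open>Arg w\<close> or
  \<open>Arg w + 2 * pi\<close>.\<close>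

lemma periodic_cis_factor_continuous:
  assumes f: "circle_continuous f"
  shows "continuous_on (sphere 0 1) (\<lambda>z. f (Arg z / (2 * pi)))"
proof (rule continuous_at_imp_continuous_on, rule ballI)
  fix z :: complex assume "z \<in> sphere 0 1"
  then have z: "z \<noteq> 0" by auto
  have cont: "isCont f x" for x
    using f by (simp add: circle_continuous_def continuous_on_eq_continuous_at)
  have f1: "f (x + 1) = f x" for x using f by (simp add: circle_continuous_def)
  show "isCont (\<lambda>z. f (Arg z / (2 * pi))) z"
  proof (cases "z \<in> \<real>\<^sub>\<le>\<^sub>0")
    case False
    then show ?thesis
      by (intro isCont_o2[OF _ cont] continuous_intros continuous_at_Arg) auto
  next
    case True
    have "f (Arg w / (2 * pi)) = f (Arg (- w) / (2 * pi) + 1 / 2)" if w: "w \<noteq> 0" for w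
    proof -
      have "Arg (- w) / (2 * pi) + 1 / 2 = Arg w / (2 * pi) \<or>
          Arg (- w) / (2 * pi) + 1 / 2 = Arg w / (2 * pi) + 1"
        using w by (simp add: Arg_minus field_simps)
      then show ?thesis using f1 by metis
    qed
    then have eq: "eventually (\<lambda>w. f (Arg w / (2 * pi)) = f (Arg (- w) / (2 * pi) + 1 / 2)) (nhds z)"
      using z by (auto intro: eventually_mono[OF t1_space_nhds[of z 0]])
    have "- z \<notin> \<real>\<^sub>\<le>\<^sub>0"
      using True z by (auto simp: complex_nonpos_Reals_iff complex_eq_iff)
    then have "isCont (\<lambda>w. f (Arg (- w) / (2 * pi) + 1 / 2)) z"
      by (intro isCont_o2[OF _ cont] continuous_intros isCont_o2[OF _ continuous_at_Arg]) auto
    then show ?thesis using isCont_cong[OF eq] by simp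
  qed
qed

text \<open>Stone-Weierstrass on the unit circle, applied to f transported by \<open>Arg\<close>;
  the real and imaginary parts of the approximating polynomial are trigonometric
  polynomials.\<close>

lemma trig_polynomial_approx:
  assumes f: "circle_continuous f" and \<epsilon>: "\<epsilon> > 0"
  obtains t where "trig_polynomial t" "\<And>x. x \<in> {0..<1} \<Longrightarrow> norm (f x - t x) < \<epsilon>"
proof -
  define g where "g z = f (Arg z / (2 * pi))" for z
  have g: "continuous_on (sphere 0 1) g"
    unfolding g_def by (rule periodic_cis_factor_continuous[OF f])
  obtain P where P: "polynomial_function P" "\<And>z. z \<in> sphere 0 1 \<Longrightarrow> norm (g z - P z) < \<epsilon>"
    using Stone_Weierstrass_polynomial_function[OF compact_sphere g \<epsilon>] by blast
  define t where "t x = of_real (Re (P (circle_char 1 x))) + \<i> * of_real (Im (P (circle_char 1 x)))" for x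
  have t_P: "t x = P (circle_char 1 x)" for x by (simp add: t_def complex_eq_iff)
  have "real_polynomial_function (Re \<circ> P)" "real_polynomial_function (Im \<circ> P)"
    using P(1) bounded_linear_Re bounded_linear_Im by (auto simp: polynomial_function_def)
  from this[THEN trig_polynomial_real_polynomial_cis]
  have "trig_polynomial t"
    unfolding t_def comp_def by (intro trig_polynomial.add trig_polynomial_mult trig_polynomial_const)
  moreover have "norm (f x - t x) < \<epsilon>" if x: "x \<in> {0..<1}" for x
  proof -
    have f1: "f (y + 1) = f y" for y using f by (simp add: circle_continuous_def)
    have "g (circle_char 1 x) = f x"
    \<comment> \<open>\<open>Arg\<close> takes values in \<open>(-pi, pi]\<close>, so beyond
      \<open>1 / 2\<close> it returns the representative \<open>x - 1\<close>.\<close>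
    proof (cases "x \<le> 1 / 2")
      case True
      then have "2 * pi * x \<le> pi" by simp
      then have "Arg (circle_char 1 x) = 2 * pi * x"
        using x pi_gt_zero unfolding circle_char_eq_cis
        by (intro cis_Arg_unique) (auto intro: less_le_trans[of _ 0])
      then show ?thesis by (simp add: g_def)
    next
      case False
      have "circle_char 1 (x - 1 + 1) = circle_char 1 (x - 1)"
        using circle_continuous_circle_char[of 1] unfolding circle_continuous_def by blast
      then have "circle_char 1 x = cis (2 * pi * (x - 1))" by (simp add: circle_char_eq_cis)
      moreover have "2 * pi * (- 1 / 2) < 2 * pi * (x - 1)" "2 * pi * (x - 1) \<le> 2 * pi * (1 / 2)"
        using False x by (intro mult_strict_left_mono mult_left_mono; simp)+
      ultimately have "Arg (circle_char 1 x) = 2 * pi * (x - 1)"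
        by (intro cis_Arg_unique) simp_all
      then show ?thesis using f1[of "x - 1"] by (simp add: g_def)
    qed
    moreover have "circle_char 1 x \<in> sphere 0 1" by (simp add: circle_char_eq_cis)
    ultimately show ?thesis using P(2) t_P by metis
  qed
  ultimately show ?thesis using that by blast
qed

section \<open>Weak* convergence from Fourier coefficients\<close>

lemma norm_integral_mult_le:
  fixes h :: "real \<Rightarrow> complex"
  assumes N: "sets N = sets circle" and f: "continuous_on UNIV f" and h: "integrable N h"
    and f_le: "\<And>x. x \<in> {0..<1} \<Longrightarrow> norm (f x) \<le> \<delta>"
  shows "norm (LINT x|N. f x * h x) \<le> \<delta> * (LINT x|N. norm (h x))"
proof -
  have space: "space N = {0..<1}" using sets_eq_imp_space_eq[OF N] by simp
  have "norm (LINT x|N. f x * h x) \<le> (LINT x|N. norm (f x * h x))"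
    by (rule integral_norm_bound)
  also have "\<dots> \<le> (LINT x|N. \<delta> * norm (h x))"
  proof (rule integral_mono)
    show "integrable N (\<lambda>x. norm (f x * h x))"
      by (intro integrable_norm integrable_continuous_mult N f h)
    show "integrable N (\<lambda>x. \<delta> * norm (h x))" using h by simp
    show "norm (f x * h x) \<le> \<delta> * norm (h x)" if "x \<in> space N" for x
      using f_le that by (simp add: space norm_mult mult_right_mono)
  qed
  finally show ?thesis by simp
qed

text \<open>Convergence is linear in the test function and so holds for trigonometric polynomials;
  the common bound on the total masses extends it to uniform limits.\<close>

lemma weak_star_convergence_from_coefficients:
  fixes h :: "nat \<Rightarrow> real \<Rightarrow> complex" and h\<^sub>0 :: "real \<Rightarrow> complex"
  assumes M: "\<And>n. sets (M n) = sets circle" "\<And>n. integrable (M n) (h n)"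
    and N: "sets N = sets circle" "integrable N h\<^sub>0"
    and bdd: "\<And>n. (LINT x|M n. norm (h n x)) \<le> B"
    and coeff: "\<And>k. (\<lambda>n. LINT x|M n. circle_char k x * h n x) \<longlonglongrightarrow> (LINT x|N. circle_char k x * h\<^sub>0 x)"
    and f: "circle_continuous f"
  shows "(\<lambda>n. LINT x|M n. f x * h n x) \<longlonglongrightarrow> (LINT x|N. f x * h\<^sub>0 x)"
proof (rule LIMSEQ_I)
  fix \<epsilon> :: real assume \<epsilon>: "\<epsilon> > 0"
  have f_cont: "continuous_on UNIV f" using f by (simp add: circle_continuous_def)
  define B' where "B' = (LINT x|N. norm (h\<^sub>0 x))"
  have "0 \<le> (LINT x|M 0. norm (h 0 x))" by simp
  then have B: "B \<ge> 0" using bdd[of 0] by linarith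
  have B': "B' \<ge> 0" by (simp add: B'_def)
  \<comment> \<open>The two approximation errors are at most \<open>\<delta> * B\<close> and
    \<open>\<delta> * B'\<close>; the added 1 keeps the denominator positive and their sum strictly
    below \<open>\<epsilon> / 2\<close>.\<close>
  define \<delta> where "\<delta> = \<epsilon> / (2 * (B + B' + 1))"
  have \<delta>: "\<delta> > 0" "\<delta> * B + \<delta> * B' < \<epsilon> / 2"
  proof -
    show "\<delta> > 0" using \<epsilon> B B' by (simp add: \<delta>_def)
    then have "\<delta> * B + \<delta> * B' < \<delta> * (B + B' + 1)" by (simp add: algebra_simps)
    also have "\<dots> = \<epsilon> / 2" using B B' by (simp add: \<delta>_def field_simps)
    finally show "\<delta> * B + \<delta> * B' < \<epsilon> / 2" .
  qed
  obtain t where t: "trig_polynomial t" "\<And>x. x \<in> {0..<1} \<Longrightarrow> norm (f x - t x) < \<delta>"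
    using trig_polynomial_approx[OF f \<delta>(1)] by blast
  have t_cont: "continuous_on UNIV t" using continuous_trig_polynomial[OF t(1)] .
  have "(\<lambda>n. LINT x|M n. t x * h n x) \<longlonglongrightarrow> (LINT x|N. t x * h\<^sub>0 x)"
    using t(1)
  proof (induction t rule: trig_polynomial.induct)
    case (monomial c k)
    then show ?case using tendsto_mult[OF tendsto_const coeff[of k], of c] by (simp add: mult.assoc)
  next
    case (add s t)
    have "integrable (M n) (\<lambda>x. s x * h n x)" "integrable (M n) (\<lambda>x. t x * h n x)"
      "integrable N (\<lambda>x. s x * h\<^sub>0 x)" "integrable N (\<lambda>x. t x * h\<^sub>0 x)" for n
      using add.hyps continuous_trig_polynomial M N by (auto intro!: integrable_continuous_mult)
    then show ?case using tendsto_add[OF add.IH] by (simp add: distrib_right)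
  qed
  then have "eventually (\<lambda>n. norm ((LINT x|M n. t x * h n x) - (LINT x|N. t x * h\<^sub>0 x)) < \<epsilon> / 2) sequentially"
    using \<epsilon> unfolding tendsto_iff dist_norm by (metis half_gt_zero)
  then have "eventually (\<lambda>n. norm ((LINT x|M n. f x * h n x) - (LINT x|N. f x * h\<^sub>0 x)) < \<epsilon>) sequentially"
  proof eventually_elim
    case (elim n)
    have diff: "(LINT x|K. f x * k x) - (LINT x|K. t x * k x) = (LINT x|K. (f x - t x) * k x)"
      if "sets K = sets circle" "integrable K k" for K and k :: "real \<Rightarrow> complex"
      using integrable_continuous_mult[OF that(1) f_cont that(2)]
        integrable_continuous_mult[OF that(1) t_cont that(2)] by (simp add: left_diff_distrib)
    have ft: "continuous_on UNIV (\<lambda>x. f x - t x)" by (intro continuous_intros f_cont t_cont)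
    have "norm ((LINT x|M n. f x * h n x) - (LINT x|M n. t x * h n x)) \<le> \<delta> * (LINT x|M n. norm (h n x))"
      unfolding diff[OF M] using t(2) by (intro norm_integral_mult_le M ft) (auto intro: less_imp_le)
    also have "\<dots> \<le> \<delta> * B" using bdd \<delta>(1) by (simp add: mult_left_mono)
    finally have 1: "norm ((LINT x|M n. f x * h n x) - (LINT x|M n. t x * h n x)) \<le> \<delta> * B" .
    have 2: "norm ((LINT x|N. f x * h\<^sub>0 x) - (LINT x|N. t x * h\<^sub>0 x)) \<le> \<delta> * B'"
      unfolding diff[OF N] B'_def using t(2) by (intro norm_integral_mult_le N ft) (auto intro: less_imp_le)
    have "norm (a - b) \<le> norm (a - a') + norm (a' - b') + norm (b - b')" for a b a' b' :: complex
    proof -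
      have "norm (a - b) = norm ((a - a') + (a' - b') - (b - b'))" by simp
      then show ?thesis
        using norm_triangle_ineq4[of "(a - a') + (a' - b')" "b - b'"] norm_triangle_ineq[of "a - a'" "a' - b'"]
        by linarith
    qed
    from this[of "LINT x|M n. f x * h n x" "LINT x|N. f x * h\<^sub>0 x" "LINT x|M n. t x * h n x" "LINT x|N. t x * h\<^sub>0 x"]
    show ?case using 1 2 elim \<delta>(2) by linarith
  qed
  then show "\<exists>n0. \<forall>n\<ge>n0. norm ((LINT x|M n. f x * h n x) - (LINT x|N. f x * h\<^sub>0 x)) < \<epsilon>"
    by (simp add: eventually_sequentially)
qed


section \<open>Fourier coefficients of the matrix products\<close>

lemma Phi_eq: "Phi a u \<omega> = (\<Sum>j | j < length u \<and> u ! j = a. circle_char (- int j) \<omega>)"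
  unfolding Phi_def circle_char_def by (intro sum.cong refl) (simp add: mult_ac)

lemma continuous_Phi: "continuous_on S (Phi a u)"
  unfolding Phi_eq[abs_def] by (intro continuous_intros continuous_circle_char)

lemma continuous_cnj_Phi: "continuous_on S (\<lambda>\<omega>. cnj (Phi a u \<omega>))"
  by (intro continuous_on_cnj continuous_Phi)

lemma integrable_circle_continuous: "continuous_on UNIV f \<Longrightarrow> integrable circle (f :: real \<Rightarrow> complex)"
proof -
  assume f: "continuous_on UNIV f"
  interpret finite_measure circle by (rule finite_measure_circle)
  show ?thesis using integrable_continuous_mult[OF refl f, of "\<lambda>_. 1"] by simp
qed

text \<open>With i a position of a and j a position of b, the product expands into characters of
  index \<open>k - i + j\<close>. Orthogonality keeps the pairs with
  \<open>i = j + k\<close>.\<close>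

lemma integral_circle_char_Phi:
  "(LINT \<omega>|circle. circle_char k \<omega> * (Phi a u \<omega> * cnj (Phi b u \<omega>)))
    = of_nat (card (pattern_positions k a b u))"
proof -
  define I where "I c = {j. j < length u \<and> u ! j = c}" for c
  have fin: "finite (I c)" for c by (simp add: I_def)
  have "circle_char k \<omega> * (Phi a u \<omega> * cnj (Phi b u \<omega>))
      = (\<Sum>i\<in>I a. \<Sum>j\<in>I b. circle_char (k - int i + int j) \<omega>)" for \<omega>
  proof -
    have "circle_char k \<omega> * (Phi a u \<omega> * cnj (Phi b u \<omega>))
        = (\<Sum>i\<in>I a. \<Sum>j\<in>I b. circle_char k \<omega> * (circle_char (- int i) \<omega> * circle_char (int j) \<omega>))"
      unfolding Phi_eq I_def cnj_sum cnj_circle_char sum_product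
      by (simp add: sum_distrib_left)
    then show ?thesis by (simp add: circle_char_add algebra_simps)
  qed
  then have "(LINT \<omega>|circle. circle_char k \<omega> * (Phi a u \<omega> * cnj (Phi b u \<omega>)))
      = (\<Sum>i\<in>I a. \<Sum>j\<in>I b. if k - int i + int j = 0 then 1 else 0)"
    by (simp add: integrable_circle_continuous continuous_circle_char integral_circle_char)
  also have "\<dots> = (\<Sum>(i, j)\<in>I a \<times> I b. if k - int i + int j = 0 then 1 else 0)"
    by (simp add: sum.cartesian_product)
  also have "\<dots> = of_nat (card {(i, j) \<in> I a \<times> I b. k - int i + int j = 0})"
    using fin by (simp add: sum.If_cases case_prod_unfold Int_def mem_Times_iff)
  also have "card {(i, j) \<in> I a \<times> I b. k - int i + int j = 0}
      = card {(i, j) \<in> I a \<times> I b. int j + k = int i}"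
    by (rule arg_cong[of _ _ card]) auto
  also have "\<dots> = card (pattern_positions k a b u)"
    by (rule bij_betw_same_card[of "\<lambda>(i, j). int j"],
        rule bij_betwI[of _ _ _ "\<lambda>j. (nat (j + k), nat j)"])
       (auto simp: I_def pattern_positions_def nat_less_iff)
  finally show ?thesis .
qed

text \<open>The product is bounded by the mean of the two squares. The integral of each square is
  the previous formula with \<open>k = 0\<close> and equal letters, that is, a number of letters in
  u.\<close>

lemma integral_norm_Phi_mult_le:
  "(LINT \<omega>|circle. norm (Phi a u \<omega> * cnj (Phi b u \<omega>))) \<le> real (length u)"
proof -
  have sq: "integrable circle (\<lambda>\<omega>. (norm (Phi c u \<omega>))\<^sup>2)"
    "(LINT \<omega>|circle. (norm (Phi c u \<omega>))\<^sup>2) \<le> real (length u)" for c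
  proof -
    have eq: "complex_of_real ((norm (Phi c u \<omega>))\<^sup>2) = Phi c u \<omega> * cnj (Phi c u \<omega>)" for \<omega>
      by (rule complex_norm_square)
    have "integrable circle (\<lambda>\<omega>. complex_of_real ((norm (Phi c u \<omega>))\<^sup>2))"
      unfolding eq
      by (intro integrable_circle_continuous continuous_on_mult continuous_Phi continuous_cnj_Phi)
    then show int: "integrable circle (\<lambda>\<omega>. (norm (Phi c u \<omega>))\<^sup>2)"
      by (simp only: complex_of_real_integrable_eq)
    have "complex_of_real (LINT \<omega>|circle. (norm (Phi c u \<omega>))\<^sup>2) = of_nat (card (pattern_positions 0 c c u))"
      unfolding integral_complex_of_real[symmetric] eq
      using integral_circle_char_Phi[of 0 c u c] by simp
    then have "(LINT \<omega>|circle. (norm (Phi c u \<omega>))\<^sup>2) = real (card (pattern_positions 0 c c u))"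
      by (metis of_real_eq_iff of_real_of_nat_eq)
    moreover have "card (pattern_positions 0 c c u) \<le> card {0..<int (length u)}"
      by (intro card_mono) (auto simp: pattern_positions_def)
    ultimately show "(LINT \<omega>|circle. (norm (Phi c u \<omega>))\<^sup>2) \<le> real (length u)" by simp
  qed
  have "(LINT \<omega>|circle. norm (Phi a u \<omega> * cnj (Phi b u \<omega>)))
      \<le> (LINT \<omega>|circle. ((norm (Phi a u \<omega>))\<^sup>2 + (norm (Phi b u \<omega>))\<^sup>2) / 2)"
  proof (rule integral_mono)
    show "integrable circle (\<lambda>\<omega>. norm (Phi a u \<omega> * cnj (Phi b u \<omega>)))"
      by (intro integrable_norm integrable_circle_continuous continuous_on_mult continuous_Phi continuous_cnj_Phi)
    show "norm (Phi a u \<omega> * cnj (Phi b u \<omega>)) \<le> ((norm (Phi a u \<omega>))\<^sup>2 + (norm (Phi b u \<omega>))\<^sup>2) / 2" for \<omega>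
      using sum_squares_bound[of "norm (Phi a u \<omega>)" "norm (Phi b u \<omega>)"] by (simp add: norm_mult)
  qed (use sq in simp)
  also have "\<dots> \<le> real (length u)" using sq[of a] sq[of b] by simp
  finally show ?thesis .
qed

text \<open>The outer conjugation leaves the factor of a unconjugated, in accordance with
  \<open>correlation\<close>, where a is the letter read at the shifted place.\<close>

lemma Pi_matrix_gram_entry:
  "map_matrix cnj (conj_transpose (Pi_matrix \<zeta> n \<omega>) ** Pi_matrix \<zeta> n \<omega>) $ a $ b
    = (\<Sum>c\<in>UNIV. Phi a (subst_iter \<zeta> n c) \<omega> * cnj (Phi b (subst_iter \<zeta> n c) \<omega>))"
  by (simp add: map_matrix_def matrix_matrix_mult_def conj_transpose_def transpose_def Pi_matrix_def)

section \<open>Convergence of the rescaled Gram densities\<close>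

context perron_substitution
begin

definition gram_density :: "'a \<Rightarrow> 'a \<Rightarrow> nat \<Rightarrow> real \<Rightarrow> complex" where
  "gram_density a b n \<omega> = of_real (inverse (\<theta> ^ n)) *
     (\<Sum>c\<in>UNIV. Phi a (subst_iter \<zeta> n c) \<omega> * cnj (Phi b (subst_iter \<zeta> n c) \<omega>))"

lemma integrable_gram_density: "integrable circle (gram_density a b n)"
  unfolding gram_density_def[abs_def]
  by (intro integrable_circle_continuous continuous_on_mult continuous_on_const continuous_on_sum
      continuous_Phi continuous_cnj_Phi)

lemma gram_density_coefficients_tendsto:
  assumes \<mu>: "shift_invariant_prob \<zeta> \<mu>"
  shows "(\<lambda>n. LINT \<omega>|circle. circle_char k \<omega> * gram_density a b n \<omega>)
    \<longlonglongrightarrow> of_real (sum r UNIV * sum l UNIV) * correlation \<zeta> \<mu> a b k"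
proof -
  let ?G = "\<lambda>u. real (card (pattern_positions k a b u))"
  obtain g where g: "\<And>e. (\<lambda>n. ?G (subst_iter \<zeta> n e) / \<theta> ^ n) \<longlonglongrightarrow> g * l e"
    using quasi_additive_growth[OF quasi_additive_card_pattern_positions] by blast
  have "(LINT \<omega>|circle. circle_char k \<omega> * gram_density a b n \<omega>)
      = of_real (\<Sum>c\<in>UNIV. ?G (subst_iter \<zeta> n c) / \<theta> ^ n)" for n
  proof -
    have "circle_char k \<omega> * gram_density a b n \<omega> = of_real (inverse (\<theta> ^ n)) * (\<Sum>c\<in>UNIV.
        circle_char k \<omega> * (Phi a (subst_iter \<zeta> n c) \<omega> * cnj (Phi b (subst_iter \<zeta> n c) \<omega>)))" for \<omega>
      by (simp add: gram_density_def sum_distrib_left mult_ac)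
    then have "(LINT \<omega>|circle. circle_char k \<omega> * gram_density a b n \<omega>)
        = of_real (inverse (\<theta> ^ n)) * (LINT \<omega>|circle. (\<Sum>c\<in>UNIV.
        circle_char k \<omega> * (Phi a (subst_iter \<zeta> n c) \<omega> * cnj (Phi b (subst_iter \<zeta> n c) \<omega>))))"
      by (simp only: integral_mult_right_zero)
    also have "(LINT \<omega>|circle. (\<Sum>c\<in>UNIV.
        circle_char k \<omega> * (Phi a (subst_iter \<zeta> n c) \<omega> * cnj (Phi b (subst_iter \<zeta> n c) \<omega>))))
        = (\<Sum>c\<in>UNIV. of_nat (card (pattern_positions k a b (subst_iter \<zeta> n c))))"
      unfolding integral_circle_char_Phi[symmetric]
      by (intro Bochner_Integration.integral_sum integrable_circle_continuous continuous_on_mult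
          continuous_circle_char continuous_Phi continuous_cnj_Phi)
    finally show ?thesis by (simp add: sum_distrib_left divide_inverse mult.commute)
  qed
  moreover have "(\<lambda>n. complex_of_real (\<Sum>c\<in>UNIV. ?G (subst_iter \<zeta> n c) / \<theta> ^ n))
      \<longlonglongrightarrow> of_real (\<Sum>c\<in>UNIV. g * l c)"
    by (intro tendsto_of_real tendsto_sum g)
  moreover have "(\<Sum>c\<in>UNIV. g * l c) = sum r UNIV * sum l UNIV * measure \<mu> (pattern_cylinder \<zeta> k a b)"
    using sum_r_pos by (simp add: measure_pattern_cylinder[OF \<mu> g] flip: sum_distrib_left)
  ultimately show ?thesis by (simp add: correlation_eq_measure[OF \<mu>])
qed

text \<open>The mass contributed by c is at most the length of \<open>\<zeta>\<^sup>n(c)\<close>,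
  whose growth is cancelled by the factor \<open>\<theta>\<^sup>-\<^sup>n\<close>.\<close>

lemma gram_density_L1_bounded:
  obtains B where "\<And>n. (LINT \<omega>|circle. norm (gram_density a b n \<omega>)) \<le> B"
proof -
  have "(LINT \<omega>|circle. norm (gram_density a b n \<omega>)) \<le> (\<Sum>c\<in>(UNIV :: 'a set). l_max / l_min)" for n
  proof -
    have \<theta>n: "\<theta> ^ n > 0" using \<theta>_gt_1 by simp
    let ?F = "\<lambda>c \<omega>. Phi a (subst_iter \<zeta> n c) \<omega> * cnj (Phi b (subst_iter \<zeta> n c) \<omega>)"
    have int: "integrable circle (\<lambda>\<omega>. norm (?F c \<omega>))" for c
      by (intro integrable_norm integrable_circle_continuous continuous_on_mult continuous_Phi continuous_cnj_Phi)
    have "(LINT \<omega>|circle. norm (gram_density a b n \<omega>))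
        \<le> (LINT \<omega>|circle. inverse (\<theta> ^ n) * (\<Sum>c\<in>UNIV. norm (?F c \<omega>)))"
    proof (rule integral_mono)
      show "integrable circle (\<lambda>\<omega>. norm (gram_density a b n \<omega>))"
        by (intro integrable_norm integrable_gram_density)
      show "integrable circle (\<lambda>\<omega>. inverse (\<theta> ^ n) * (\<Sum>c\<in>UNIV. norm (?F c \<omega>)))"
        by (intro integrable_mult_right Bochner_Integration.integrable_sum int)
      show "norm (gram_density a b n \<omega>) \<le> inverse (\<theta> ^ n) * (\<Sum>c\<in>UNIV. norm (?F c \<omega>))" for \<omega>
      proof -
        have "norm (gram_density a b n \<omega>) = inverse (\<theta> ^ n) * norm (\<Sum>c\<in>UNIV. ?F c \<omega>)"
          unfolding gram_density_def norm_mult[of "of_real (inverse (\<theta> ^ n))"] norm_of_real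
          using \<theta>n by simp
        also have "\<dots> \<le> inverse (\<theta> ^ n) * (\<Sum>c\<in>UNIV. norm (?F c \<omega>))"
          by (intro mult_left_mono norm_sum) (use \<theta>n in simp)
        finally show ?thesis .
      qed
    qed
    also have "\<dots> = inverse (\<theta> ^ n) * (\<Sum>c\<in>UNIV. LINT \<omega>|circle. norm (?F c \<omega>))"
      unfolding integral_mult_right_zero using int by (subst Bochner_Integration.integral_sum) simp_all
    also have "\<dots> \<le> inverse (\<theta> ^ n) * (\<Sum>c\<in>(UNIV :: 'a set). \<theta> ^ n * (l_max / l_min))"
      by (intro mult_left_mono sum_mono order_trans[OF integral_norm_Phi_mult_le length_iter_le])
         (use \<theta>n in simp)
    also have "\<dots> = (\<Sum>c\<in>(UNIV :: 'a set). l_max / l_min)"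
      using \<theta>_gt_1 by (simp flip: sum_distrib_left)
    finally show ?thesis .
  qed
  then show ?thesis using that by blast
qed

theorem gram_density_weak_star_limit:
  assumes \<mu>: "shift_invariant_prob \<zeta> \<mu>" and \<sigma>: "is_correlation_measure \<zeta> \<mu> a b \<sigma>"
  shows "weak_star_limit (\<lambda>n. with_density circle (gram_density a b n))
    (\<lambda>A. of_real (sum r UNIV * sum l UNIV) * \<sigma> A)"
proof -
  define C where "C = complex_of_real (sum r UNIV * sum l UNIV)"
  have coeff: "has_complex_measure_integral circle \<sigma> (circle_char k) (correlation \<zeta> \<mu> a b k)" for k
    using \<sigma> unfolding is_correlation_measure_def circle_char_def[abs_def] by blast
  \<comment> \<open>Any one representation of \<sigma> will do, here that for \<open>k = 0\<close>;
    uniqueness of the integral yields the other coefficients from it.\<close>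
  obtain N h where N: "finite_measure N" "sets N = sets circle" "integrable N h"
      "\<And>A. A \<in> sets circle \<Longrightarrow> \<sigma> A = with_density N h A"
    using coeff[of 0] unfolding has_complex_measure_integral_def by blast
  have Ch: "integrable N (\<lambda>x. C * h x)" using N(3) by simp
  obtain B where B: "\<And>n. (LINT \<omega>|circle. norm (gram_density a b n \<omega>)) \<le> B"
    using gram_density_L1_bounded by blast
  have lim: "(\<lambda>n. LINT x|circle. f x * gram_density a b n x) \<longlonglongrightarrow> (LINT x|N. f x * (C * h x))"
    if "circle_continuous f" for f
  proof (rule weak_star_convergence_from_coefficients[OF refl integrable_gram_density N(2) Ch B _ that])
    show "(\<lambda>n. LINT x|circle. circle_char k x * gram_density a b n x)
        \<longlonglongrightarrow> (LINT x|N. circle_char k x * (C * h x))" for k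
    proof -
      have "(LINT x|N. circle_char k x * (C * h x)) = C * (LINT x|N. circle_char k x * h x)"
        by (simp add: mult.left_commute[of _ C])
      also have "(LINT x|N. circle_char k x * h x) = correlation \<zeta> \<mu> a b k"
        by (rule has_complex_measure_integral_unique[OF coeff continuous_circle_char N(2-4)])
      finally show ?thesis using gram_density_coefficients_tendsto[OF \<mu>, of k a b] by (simp add: C_def)
    qed
  qed
  have dens: "C * \<sigma> A = with_density N (\<lambda>x. C * h x) A" if "A \<in> sets circle" for A
    using N(4)[OF that] by (simp add: with_density_def)
  show ?thesis unfolding weak_star_limit_def C_def[symmetric]
  proof (intro conjI allI impI)
    show "complex_measure circle (with_density circle (gram_density a b n))" for n
      by (intro complex_measure_with_density integrable_gram_density refl)
    show "complex_measure circle (\<lambda>A. C * \<sigma> A)"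
      using \<sigma> by (auto simp: is_correlation_measure_def complex_measure_def intro: sums_mult)
    fix f assume f: "circle_continuous f"
    then have f_cont: "continuous_on UNIV f" by (simp add: circle_continuous_def)
    have "has_complex_measure_integral circle (with_density circle (gram_density a b n)) f
        (LINT x|circle. f x * gram_density a b n x)" for n
      unfolding has_complex_measure_integral_def
      using finite_measure_circle integrable_gram_density
        has_bochner_integral_integrable[OF integrable_continuous_mult[OF refl f_cont integrable_gram_density]]
      by blast
    moreover have "has_complex_measure_integral circle (\<lambda>A. C * \<sigma> A) f (LINT x|N. f x * (C * h x))"
      unfolding has_complex_measure_integral_def
      using N(1,2) Ch dens has_bochner_integral_integrable[OF integrable_continuous_mult[OF N(2) f_cont Ch]]
      by blast
    ultimately show "\<exists>I J. (\<forall>n. has_complex_measure_integral circle (with_density circle (gram_density a b n)) f (I n)) \<and>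
        has_complex_measure_integral circle (\<lambda>A. C * \<sigma> A) f J \<and> I \<longlonglongrightarrow> J"
      using lim[OF f]
      by (intro exI[of _ "\<lambda>n. LINT x|circle. f x * gram_density a b n x"]
          exI[of _ "LINT x|N. f x * (C * h x)"]) blast
  qed
qed

end

section \<open>From Perron-Frobenius eigenvectors to correlation measures\<close>

text \<open>The sign s makes l positive. Applying it to r as well preserves the normalisation, since
  s occurs twice.\<close>

lemma perron_substitution_of_eigenvectors:
  fixes \<zeta> :: "'a::finite \<Rightarrow> 'a list" and r l :: "real^'a"
  assumes card: "CARD('a) \<ge> 2" and prim: "primitive_subst \<zeta>"
    and pf: "perron_frobenius_eigenvalue (subst_matrix \<zeta>) \<theta>"
    and r: "subst_matrix \<zeta> *v r = \<theta> *\<^sub>R r"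
    and l: "transpose (subst_matrix \<zeta>) *v l = \<theta> *\<^sub>R l"
    and rl: "r \<bullet> l = 1"
  obtains p s where "perron_substitution \<zeta> \<theta> (\<lambda>e. s * l $ e) (\<lambda>e. s * r $ e) p" "s * s = 1"
proof -
  let ?S = "subst_matrix \<zeta>"
  obtain p where p: "p \<ge> 1" "\<And>i j. mat_power ?S p $ i $ j > 0"
    using prim by (auto simp: primitive_subst_def)
  have nonneg: "?S $ i $ j \<ge> 0" for i j by (simp add: subst_matrix_def)
  have "l \<noteq> 0" using rl by auto
  note signed = perron_frobenius_left_eigenvector_signed[OF nonneg p pf l this]
  define s :: real where "s = (if \<forall>i. l $ i > 0 then 1 else - 1)"
  have s: "s * s = 1" "\<And>e. s * l $ e > 0" using signed(2) by (auto simp: s_def)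
  have mixing: "d \<in> set (subst_iter \<zeta> p e)" for d e
    using p(2)[of d e] by (simp add: mat_power_subst_matrix) (metis count_notin less_irrefl)
  have left: "sum_list (map (\<lambda>e. s * l $ e) (\<zeta> e)) = \<theta> * (s * l $ e)" for e
  proof -
    have "\<theta> * l $ e = (transpose ?S *v l) $ e" by (simp only: l vector_scaleR_component real_scaleR_def)
    also have "\<dots> = (\<Sum>d\<in>UNIV. real (count_list (\<zeta> e) d) * l $ d)"
      unfolding matrix_vector_mult_def by (simp add: transpose_def subst_matrix_def)
    also have "\<dots> = sum_list (map (($) l) (\<zeta> e))" by (simp add: sum_list_map_count_real)
    finally have "\<theta> * (s * l $ e) = s * sum_list (map (($) l) (\<zeta> e))" by simp
    then show ?thesis by (simp only: sum_list_const_mult)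
  qed
  note left_iter = left_eigenvector_subst_iter[of "\<lambda>e. s * l $ e" \<zeta> \<theta>, OF left]
  \<comment> \<open>As there are two letters and \<open>subst_iter \<zeta> p e\<close> contains
    both, its weight \<open>\<theta> ^ p * (s * l $ e)\<close> exceeds the weight of e
    alone.\<close>
  have "\<theta> > 1"
  proof -
    obtain e d :: 'a where ed: "e \<noteq> d"
      using card card_le_Suc0_iff_eq[of "UNIV :: 'a set"] by auto
    have "s * l $ e < s * l $ e + s * l $ d" using s(2) by simp
    also have "\<dots> = (\<Sum>c\<in>{e, d}. s * l $ c)" using ed by simp
    also have "\<dots> \<le> (\<Sum>c\<in>UNIV. s * l $ c)" by (rule sum_mono2) (use s(2) in \<open>auto intro: less_imp_le\<close>)
    also have "\<dots> \<le> (\<Sum>c\<in>UNIV. real (count_list (subst_iter \<zeta> p e) c) * (s * l $ c))"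
    proof (rule sum_mono)
      fix c
      have "1 \<le> real (count_list (subst_iter \<zeta> p e) c)"
        using mixing[of c e] by (metis count_list_0_iff less_one linorder_not_less of_nat_1 of_nat_le_iff)
      then show "s * l $ c \<le> real (count_list (subst_iter \<zeta> p e) c) * (s * l $ c)"
        using s(2)[of c] by (metis less_imp_le mult_1 mult_right_mono)
    qed
    also have "\<dots> = \<theta> ^ p * (s * l $ e)"
      by (simp only: left_iter flip: sum_list_map_count_real)
    finally have "1 * (s * l $ e) < \<theta> ^ p * (s * l $ e)" by simp
    then have "1 < \<theta> ^ p" by (rule mult_right_less_imp_less) (use s(2) in \<open>auto intro: less_imp_le\<close>)
    then show ?thesis using signed(1) by (metis linorder_not_less order.strict_implies_order power_le_one)
  qed
  have "perron_substitution \<zeta> \<theta> (\<lambda>e. s * l $ e) (\<lambda>e. s * r $ e) p"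
  proof
    show "(\<Sum>e\<in>UNIV. real (count_list (\<zeta> e) d) * (s * r $ e)) = \<theta> * (s * r $ d)" for d
    proof -
      have "\<theta> * r $ d = (?S *v r) $ d" by (simp add: r)
      also have "\<dots> = (\<Sum>e\<in>UNIV. real (count_list (\<zeta> e) d) * r $ e)"
        by (simp add: matrix_vector_mult_def subst_matrix_def)
      finally have "\<theta> * (s * r $ d) = s * (\<Sum>e\<in>UNIV. real (count_list (\<zeta> e) d) * r $ e)" by simp
      then show ?thesis by (simp add: sum_distrib_left mult.left_commute)
    qed
    have "(\<Sum>e\<in>UNIV. s * r $ e * (s * l $ e)) = s * s * (r \<bullet> l)"
      by (simp add: inner_vec_def sum_distrib_left mult_ac)
    then show "(\<Sum>e\<in>UNIV. s * r $ e * (s * l $ e)) = 1" using s(1) rl by simp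
  qed (fact left s(2) \<open>\<theta> > 1\<close> mixing)+
  with s(1) that show ?thesis by blast
qed

theorem lemma2p2:
  fixes \<zeta> :: "'a::finite \<Rightarrow> 'a list"
    and \<mu> :: "(int \<Rightarrow> 'a) measure"
    and \<sigma> :: "'a \<Rightarrow> 'a \<Rightarrow> real set \<Rightarrow> complex"
    and \<theta> :: real
    and r l :: "real^'a"
  assumes "CARD('a) \<ge> 2"
    and "substitution \<zeta>"
    and "primitive_subst \<zeta>"
    and "aperiodic_subst \<zeta>"
    and "shift_invariant_prob \<zeta> \<mu>"
    and "\<And>a b. is_correlation_measure \<zeta> \<mu> a b (\<sigma> a b)"
    and "perron_frobenius_eigenvalue (subst_matrix \<zeta>) \<theta>"
    and "subst_matrix \<zeta> *v r = \<theta> *\<^sub>R r"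
    and "transpose (subst_matrix \<zeta>) *v l = \<theta> *\<^sub>R l"
    and "r \<bullet> l = 1"
  shows "\<exists>\<Lambda> :: 'a \<Rightarrow> 'a \<Rightarrow> real set \<Rightarrow> complex.
    (\<forall>a b. weak_star_limit
       (\<lambda>n. with_density circle
          (\<lambda>\<omega>. of_real (inverse (\<theta> ^ n)) *
             map_matrix cnj (conj_transpose (Pi_matrix \<zeta> n \<omega>) ** Pi_matrix \<zeta> n \<omega>) $ a $ b))
       (\<Lambda> a b)) \<and>
    (\<forall>a b. \<forall>A\<in>sets circle.
       \<sigma> a b A = of_real (1 / ((r \<bullet> 1) * (1 \<bullet> l))) * \<Lambda> a b A)"
proof -
  obtain p s where ps: "perron_substitution \<zeta> \<theta> (\<lambda>e. s * l $ e) (\<lambda>e. s * r $ e) p" "s * s = 1"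
    using perron_substitution_of_eigenvectors[OF assms(1,3,7-10)] by blast
  interpret perron_substitution \<zeta> \<theta> "\<lambda>e. s * l $ e" "\<lambda>e. s * r $ e" p by (fact ps(1))
  define C where "C = (\<Sum>e\<in>UNIV. s * r $ e) * (\<Sum>e\<in>UNIV. s * l $ e)"
  have "(\<Sum>e\<in>UNIV. s * l $ e) > 0" by (intro sum_pos) (auto intro: l_pos)
  with sum_r_pos have C_pos: "C > 0" by (simp add: C_def)
  have "C = s * s * ((r \<bullet> 1) * (1 \<bullet> l))"
    by (simp add: C_def inner_vec_def flip: sum_distrib_left)
  then have C: "C = (r \<bullet> 1) * (1 \<bullet> l)" by (simp only: ps(2) mult_1)
  show ?thesis
  \<comment> \<open>The limit is known to be C times \<sigma>, so this is the witness; the stated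
    identity then only divides by the nonzero C.\<close>
  proof (intro exI[of _ "\<lambda>a b A. of_real C * \<sigma> a b A"] conjI allI ballI)
    show "weak_star_limit
       (\<lambda>n. with_density circle
          (\<lambda>\<omega>. of_real (inverse (\<theta> ^ n)) *
             map_matrix cnj (conj_transpose (Pi_matrix \<zeta> n \<omega>) ** Pi_matrix \<zeta> n \<omega>) $ a $ b))
       (\<lambda>A. of_real C * \<sigma> a b A)" for a b
      using gram_density_weak_star_limit[OF assms(5,6), of a b]
      unfolding gram_density_def Pi_matrix_gram_entry C_def .
    show "\<sigma> a b A = of_real (1 / ((r \<bullet> 1) * (1 \<bullet> l))) * (of_real C * \<sigma> a b A)" for a b A
      using C_pos unfolding C[symmetric] by simp
  qed
qed

end
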